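(* Let $k$ be a field, $R=k[x_1,x_2,x_3]$, and let $I(K_3)=\langle x_1x_2,x_1x_3,x_2x_3\rangle\subset R$ be the edge ideal of the complete graph $K_3$. Let $s\ge 1$ be an integer. Then for all positive integers $i,j$, the graded Betti numbers $\beta_{i,j}(I(K_3)^{(s)})$ (indexed as in the context, so that $i=1$ corresponds to minimal generators) are: $$\beta_{i,j}(I(K_3)^{(s)})=\begin{cases}1 & \text{if } i=1,\ j=\tfrac{3s}{2},\\ 2 & \text{if } i=2,\ j=\tfrac{3s+3}{2},\\ 3 & \text{if } i=1,\ \tfrac{3s+1}{2}\le j\le 2s,\\ 3 & \text{if } i=2,\ \tfrac{3s+4}{2}\le j\le 2s+1,\\ 0 & \text{otherwise.}\end{cases}$$ (A condition such as $j=\frac{3s}{2}$ is vacuous when the right-hand side is not an integer.)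
   Context: Indexing convention: for a homogeneous ideal $I\subset R$ and $i\ge 1$, $\beta_{i,j}(I):=\dim_k\mathrm{Tor}^R_{i-1}(k,I)_j$; equivalently, $\beta_{i,j}(I)$ is the number of copies of $R(-j)$ in homological position $i$ of the graded minimal free resolution of $R/I$ (with $R$ in position $0$). Symbolic powers: for a monomial ideal $I\subset R$ with primary decomposition $I=I_1\cap\dots\cap I_n$, and $Q$ an associated prime of $I$ maximal under inclusion, put $I_{\subseteq Q}=\bigcap_{\sqrt{I_\ell}\subseteq Q}I_\ell$; then $I^{(s)}=\bigcap_{Q}I_{\subseteq Q}^s$, the intersection running over all associated primes $Q$ of $I$ that are maximal with respect to inclusion. *)

theory Defs
  imports Complex_Main "HOL-Library.Poly_Mapping" "HOL-Library.Numeral_Type"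
begin

section \<open>Ideals of a commutative ring\<close>

global_interpretation ideal: module "(*) :: 'a::comm_ring_1 \<Rightarrow> 'a \<Rightarrow> 'a"
  by unfold_locales (simp_all add: algebra_simps)

abbreviation is_ideal :: "'a::comm_ring_1 set \<Rightarrow> bool"
  where "is_ideal \<equiv> ideal.subspace"

abbreviation ideal_gen :: "'a::comm_ring_1 set \<Rightarrow> 'a set"
  where "ideal_gen \<equiv> ideal.span"

definition ideal_mult :: "'a::comm_ring_1 set \<Rightarrow> 'a set \<Rightarrow> 'a set"
  where "ideal_mult I J = ideal_gen {a * b | a b. a \<in> I \<and> b \<in> J}"

primrec ideal_power :: "'a::comm_ring_1 set \<Rightarrow> nat \<Rightarrow> 'a set"
  where "ideal_power I 0 = UNIV"
      | "ideal_power I (Suc n) = ideal_mult I (ideal_power I n)"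

definition radical :: "'a::comm_ring_1 set \<Rightarrow> 'a set"
  where "radical I = {f. \<exists>n. f ^ n \<in> I}"

definition prime_ideal :: "'a::comm_ring_1 set \<Rightarrow> bool"
  where "prime_ideal P \<longleftrightarrow> is_ideal P \<and> P \<noteq> UNIV \<and>
           (\<forall>a b. a * b \<in> P \<longrightarrow> a \<in> P \<or> b \<in> P)"

definition primary_ideal :: "'a::comm_ring_1 set \<Rightarrow> bool"
  where "primary_ideal P \<longleftrightarrow> is_ideal P \<and> P \<noteq> UNIV \<and>
           (\<forall>a b. a * b \<in> P \<longrightarrow> a \<in> P \<or> b \<in> radical P)"

definition primary_decomposition :: "'a::comm_ring_1 set set \<Rightarrow> 'a set \<Rightarrow> bool"
  where "primary_decomposition D I \<longleftrightarrow> finite D \<and> (\<forall>P\<in>D. primary_ideal P) \<and> \<Inter>D = I"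

definition associated_primes :: "'a::comm_ring_1 set \<Rightarrow> 'a set set"
  where "associated_primes I = {P. prime_ideal P \<and> (\<exists>f. P = {g. g * f \<in> I})}"

definition maximal_associated_primes :: "'a::comm_ring_1 set \<Rightarrow> 'a set set"
  where "maximal_associated_primes I =
           {Q \<in> associated_primes I. \<forall>P \<in> associated_primes I. Q \<subseteq> P \<longrightarrow> P = Q}"


section \<open>Symbolic powers\<close>

definition components_below :: "'a::comm_ring_1 set set \<Rightarrow> 'a set \<Rightarrow> 'a set"
  where "components_below D Q = \<Inter>{P \<in> D. radical P \<subseteq> Q}"

text \<open>The primary decomposition is an arbitrary one (not necessarily irredundant); by
  \<open>symbolic_power_eq\<close> below the result does not depend on the choice.\<close>

definition symbolic_power :: "'a::comm_ring_1 set \<Rightarrow> nat \<Rightarrow> 'a set"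
  where "symbolic_power I s =
           (let D = (SOME D. primary_decomposition D I)
            in \<Inter>Q \<in> maximal_associated_primes I. ideal_power (components_below D Q) s)"

lemma prime_ideal_prod:
  assumes "prime_ideal Q" "finite A" "\<And>x. x \<in> A \<Longrightarrow> g x \<notin> Q"
  shows "prod g A \<notin> Q"
  using assms(2,3)
proof (induction A rule: finite_induct)
  case empty
  have "x \<in> Q" if "1 \<in> Q" for x
    using ideal.subspace_scale[of Q 1 x] assms(1) that by (simp add: prime_ideal_def)
  moreover have "Q \<noteq> UNIV" using assms(1) by (simp add: prime_ideal_def)
  ultimately show ?case by auto
next
  case (insert x A)
  moreover have "a \<in> Q \<or> b \<in> Q" if "a * b \<in> Q" for a b
    using assms(1) that unfolding prime_ideal_def by blast
  ultimately show ?case by (metis insertI1 insertI2 prod.insert)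
qed

lemma components_below_eq:
  assumes D: "primary_decomposition D I" and Q: "prime_ideal Q"
  shows "components_below D Q = {f. \<exists>g. g \<notin> Q \<and> g * f \<in> I}"
proof (intro set_eqI iffI)
  fix f assume f: "f \<in> components_below D Q"
  define A where "A = {P \<in> D. \<not> radical P \<subseteq> Q}"
  have "\<exists>h. h \<notin> Q \<and> h \<in> P" if P: "P \<in> A" for P
  proof -
    obtain r n where r: "r \<notin> Q" "r ^ n \<in> P" using P by (auto simp: A_def radical_def)
    have "r ^ n \<notin> Q" using prime_ideal_prod[OF Q, of "{..<n}" "\<lambda>_. r"] r(1) by simp
    then show ?thesis using r(2) by blast
  qed
  then obtain h where h: "\<And>P. P \<in> A \<Longrightarrow> h P \<notin> Q \<and> h P \<in> P" by metis
  have fin: "finite A" using D by (auto simp: A_def primary_decomposition_def)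
  have "prod h A * f \<in> P" if P: "P \<in> D" for P
  proof (cases "P \<in> A")
    case True
    have eq: "prod h A * f = (prod h (A - {P}) * f) * h P"
      by (subst prod.remove[OF fin True, of h]) (simp only: mult_ac)
    have "is_ideal P" using D P by (auto simp: primary_decomposition_def primary_ideal_def)
    then show ?thesis 
      unfolding eq using h[OF True] by (blast intro: ideal.subspace_scale[of P "h P"])
  next
    case False
    have "is_ideal P" using D P by (auto simp: primary_decomposition_def primary_ideal_def)
    moreover have "f \<in> P" using f False P by (auto simp: components_below_def A_def)
    ultimately show ?thesis by (rule ideal.subspace_scale)
  qed
  then have "prod h A * f \<in> I" using D by (auto simp: primary_decomposition_def)
  moreover have "prod h A \<notin> Q" using prime_ideal_prod[OF Q fin] h by blast
  ultimately show "f \<in> {f. \<exists>g. g \<notin> Q \<and> g * f \<in> I}" by blast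
next
  fix f assume "f \<in> {f. \<exists>g. g \<notin> Q \<and> g * f \<in> I}"
  then obtain g where "g \<notin> Q" "g * f \<in> I" by blast
  then have g: "g \<notin> Q" "f * g \<in> I" by (metis mult.commute)+
  show "f \<in> components_below D Q"
    unfolding components_below_def
  proof safe
    fix P assume P: "P \<in> D" "radical P \<subseteq> Q"
    then have "primary_ideal P" "f * g \<in> P" "g \<notin> radical P"
      using D g unfolding primary_decomposition_def by blast+
    then show "f \<in> P" unfolding primary_ideal_def by blast
  qed
qed

lemma symbolic_power_eq:
  assumes "primary_decomposition D I"
  shows "symbolic_power I s =
           (\<Inter>Q \<in> maximal_associated_primes I. ideal_power (components_below D Q) s)"
proof -
  have "primary_decomposition (SOME D. primary_decomposition D I) I"
    using assms by (rule someI)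
  then have "components_below (SOME D. primary_decomposition D I) Q = components_below D Q"
    if "Q \<in> maximal_associated_primes I" for Q
    using that assms
    by (simp add: maximal_associated_primes_def associated_primes_def components_below_eq)
  then show ?thesis by (simp add: symbolic_power_def Let_def)
qed


section \<open>Polynomial rings and edge ideals\<close>

text \<open>The polynomial ring over \<open>'k\<close> in the variables indexed by the finite type \<open>'v\<close>;
  monomials are exponent vectors.\<close>

type_synonym ('v, 'k) mpoly = "('v \<Rightarrow>\<^sub>0 nat) \<Rightarrow>\<^sub>0 'k"

definition X :: "'v \<Rightarrow> ('v, 'k::field) mpoly"
  where "X v = Poly_Mapping.single (Poly_Mapping.single v 1) 1"

definition mono_degree :: "('v::finite \<Rightarrow>\<^sub>0 nat) \<Rightarrow> nat"
  where "mono_degree m = (\<Sum>v\<in>UNIV. Poly_Mapping.lookup m v)"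

definition irrelevant_ideal :: "('v, 'k::field) mpoly set"
  where "irrelevant_ideal = ideal_gen (range X)"

text \<open>A simple graph with vertex set \<open>UNIV :: 'v set\<close> is given by its set of edges, each a
  two-element set of vertices.\<close>

definition edge_ideal :: "'v set set \<Rightarrow> ('v, 'k::field) mpoly set"
  where "edge_ideal E = ideal_gen {X u * X v | u v. {u, v} \<in> E}"

definition complete_graph :: "'v set set"
  where "complete_graph = {{u, v} | u v. u \<noteq> v}"

lemma edge_ideal_K3:
  "edge_ideal (complete_graph :: 3 set set) =
     (ideal_gen {X 1 * X 2, X 1 * X 3, X 2 * X 3} :: (3, 'k::field) mpoly set)"
proof -
  have ex: "v = 1 \<or> v = 2 \<or> v = 3" for v :: 3
  proof (induct v)
    case (of_int z)
    then have "z = 0 \<or> z = 1 \<or> z = 2" by auto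
    then show ?case by auto
  qed
  have ne: "(1::3) \<noteq> 2" "(1::3) \<noteq> 3" "(2::3) \<noteq> 3" by simp_all
  have "{X u * X v | u v :: 3. {u, v} \<in> complete_graph} =
     {X 1 * X 2, X 1 * X 3, X 2 * X 3 :: (3, 'k) mpoly}"
  proof (intro equalityI subsetI)
    fix p :: "(3, 'k) mpoly"
    assume "p \<in> {X u * X v | u v :: 3. {u, v} \<in> complete_graph}"
    then obtain u v :: 3 where p: "p = X u * X v" "u \<noteq> v"
      by (auto simp: complete_graph_def doubleton_eq_iff)
    then show "p \<in> {X 1 * X 2, X 1 * X 3, X 2 * X 3}"
      using ex[of u] ex[of v] by (auto simp: mult.commute)
  next
    fix p :: "(3, 'k) mpoly"
    assume "p \<in> {X 1 * X 2, X 1 * X 3, X 2 * X 3}"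
    then obtain u v :: 3 where "p = X u * X v" "u \<noteq> v" using ne by auto
    then show "p \<in> {X u * X v | u v :: 3. {u, v} \<in> complete_graph}"
      unfolding complete_graph_def by blast
  qed
  then show ?thesis by (simp add: edge_ideal_def)
qed


section \<open>Graded minimal free resolutions and graded Betti numbers\<close>

text \<open>The free module on a finite set \<open>B\<close>, and the map given by a matrix whose columns are
  indexed by \<open>C\<close> and whose rows are indexed by \<open>B\<close>.\<close>

definition free_module :: "'b set \<Rightarrow> ('b \<Rightarrow> 'a::comm_ring_1) set"
  where "free_module B = {v. \<forall>p. p \<notin> B \<longrightarrow> v p = 0}"

definition mat_map ::
    "'b set \<Rightarrow> 'c set \<Rightarrow> ('b \<Rightarrow> 'c \<Rightarrow> 'a::comm_ring_1) \<Rightarrow> ('c \<Rightarrow> 'a) \<Rightarrow> ('b \<Rightarrow> 'a)"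
  where "mat_map B C M v = (\<lambda>p. if p \<in> B then \<Sum>q\<in>C. M p q * v q else 0)"

text \<open>Homogeneous basis of the graded free module in position \<open>i\<close>, the direct sum over \<open>j\<close> of
  \<open>b i j\<close> copies of \<open>R(-j)\<close>: the pair \<open>(j, c)\<close> is the generator, of degree \<open>j\<close>, of the
  \<open>c\<close>-th copy of \<open>R(-j)\<close>. Natural numbers suffice as twists: the module in position \<open>0\<close> is \<open>R\<close>,
  and by minimality each differential sends a basis element of degree \<open>j\<close> to a nonzero element of
  degree \<open>j\<close>.\<close>

definition res_basis :: "(nat \<Rightarrow> nat \<Rightarrow> nat) \<Rightarrow> nat \<Rightarrow> (nat \<times> nat) set"
  where "res_basis b i = {(j, c). c < b i j}"

text \<open>\<open>M (Suc i)\<close> is the matrix of the differential from position \<open>Suc i\<close> to position \<open>i\<close>. The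
  degree condition on its entries says that this differential is homogeneous of degree \<open>0\<close>;
  minimality says that the entries lie in the irrelevant ideal.\<close>

definition minimal_graded_resolution ::
    "('v::finite, 'k::field) mpoly set \<Rightarrow> (nat \<Rightarrow> nat \<Rightarrow> nat) \<Rightarrow>
     (nat \<Rightarrow> nat \<times> nat \<Rightarrow> nat \<times> nat \<Rightarrow> ('v, 'k) mpoly) \<Rightarrow> bool"
  where "minimal_graded_resolution I b M \<longleftrightarrow>
     (\<forall>i. finite (res_basis b i)) \<and>
     (\<forall>j. b 0 j = (if j = 0 then 1 else 0)) \<and>
     (\<forall>i. \<forall>p\<in>res_basis b i. \<forall>q\<in>res_basis b (Suc i).
        (\<forall>m\<in>Poly_Mapping.keys (M (Suc i) p q). mono_degree m + fst p = fst q) \<and>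
        M (Suc i) p q \<in> irrelevant_ideal) \<and>
     mat_map (res_basis b 0) (res_basis b 1) (M 1) ` free_module (res_basis b 1) =
       {v \<in> free_module (res_basis b 0). v (0, 0) \<in> I} \<and>
     (\<forall>i. mat_map (res_basis b (Suc i)) (res_basis b (Suc (Suc i))) (M (Suc (Suc i))) `
            free_module (res_basis b (Suc (Suc i))) =
          {v \<in> free_module (res_basis b (Suc i)).
             mat_map (res_basis b i) (res_basis b (Suc i)) (M (Suc i)) v = (\<lambda>_. 0)})"

text \<open>The number of copies of \<open>R(-j)\<close> in position \<open>i\<close> of the graded minimal free resolution of
  \<open>R/I\<close>, with \<open>R\<close> in position \<open>0\<close>; for \<open>i \<ge> 1\<close> it is the dimension of the degree \<open>j\<close> part of
  \<open>Tor\<^sub>i\<^sub>-\<^sub>1(k, I)\<close>. The graded minimal free resolution of a proper homogeneous ideal exists and is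
  unique up to isomorphism, which makes the description definite.\<close>

definition graded_betti :: "nat \<Rightarrow> nat \<Rightarrow> ('v::finite, 'k::field) mpoly set \<Rightarrow> nat"
  where "graded_betti i j I = (THE n. \<exists>b M. minimal_graded_resolution I b M \<and> n = b i j)"

end

theory Submission
  imports Defs "HOL-Library.Function_Algebras"
begin

text \<open>
  Why the theorem holds. Let \<open>P\<^sub>w\<close> be the prime generated by all variables except \<open>x\<^sub>w\<close>. The edge
  ideal of a complete graph is the intersection of the \<open>P\<^sub>w\<close>, these are its associated primes, and
  none contains another. So its symbolic power is the intersection of the powers \<open>P\<^sub>w\<^sup>s\<close>, which are
  monomial ideals: for the triangle, \<open>x\<^sup>m\<close> lies in the symbolic power exactly if any two of the
  three exponents of \<open>m\<close> add up to at least \<open>s\<close> (\<open>symbolic_power_complete_graph\<close>,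
  \<open>two_coordinate_sums\<close>).

  The minimal monomials with this property have some exponent \<open>t \<le> s/2\<close> at one variable and \<open>s - t\<close>
  at the two others, hence degree \<open>2 s - t\<close>. There are three of them for each \<open>t < s/2\<close>, and the
  three coincide for \<open>t = s/2\<close>. They form three arms, one for each variable, which start near degree
  \<open>3 s/2\<close> and go outwards with increasing degree. Order them by degree. For every generator \<open>g\<close> but
  the first, say on the arm of \<open>x\<^sub>c\<close>, the earlier generators all have a larger exponent at \<open>x\<^sub>c\<close>, and
  one of them divides \<open>x\<^sub>c g\<close>; so the ideal of the \<open>f\<close> with \<open>f g\<close> in the span of the earlier generators
  is generated by \<open>x\<^sub>c\<close>. Hence every generator but the first contributes exactly one syzygy, in degree
  one above its own, and these syzygies form a triangular matrix with the non-zero-divisors \<open>x\<^sub>c\<close> on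
  the diagonal. The matrix is therefore injective and its image is the whole syzygy module
  (\<open>triangular_syzygies\<close>), which yields a minimal resolution of length two (\<open>K3_resolution\<close>). Its
  second row of Betti numbers is the first row shifted by one degree, less the one missing syzygy
  in the lowest degree; this explains the entry \<open>2\<close> for odd \<open>s\<close> and its absence for even \<open>s\<close>.

  A graded Betti number is defined by a definite description, so one also needs that two minimal
  graded resolutions \<open>F\<close> and \<open>F'\<close> of an ideal have the same ranks. The identity lifts to homogeneous
  chain maps \<open>F \<rightarrow> F' \<rightarrow> F\<close> (\<open>comparison_map\<close>), whose composition is homotopic to the identity. As the
  differentials have no constant coefficients, the constant coefficients of the composition form an
  identity matrix (\<open>null_homotopic_const_coeff\<close>), and homogeneity makes this an identity matrix
  separately in each degree, so the ranks of \<open>F\<close> are at most those of \<open>F'\<close> (\<open>betti_le\<close>).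
\<close>

section \<open>Polynomials and their monomials\<close>

lemma mono_degree_add [simp]: "mono_degree (m + n) = mono_degree m + mono_degree n"
  by (simp add: mono_degree_def lookup_add sum.distrib)

lemma poly_as_sum_of_monomials:
  "f = (\<Sum>m\<in>Poly_Mapping.keys f. Poly_Mapping.single m (Poly_Mapping.lookup f m))"
  by (intro poly_mapping_eqI)
    (simp add: lookup_sum lookup_single when_def sum.delta' in_keys_iff)

text \<open>The additive projection onto the span of the monomials with exponent in \<open>T\<close>. For \<open>T\<close> given by a
  degree it takes homogeneous components, for \<open>T = {0}\<close> the constant term, and for \<open>T\<close> the exponents
  in some of the variables it sets the other variables to zero.\<close>

definition restrict_exponents :: "('v \<Rightarrow>\<^sub>0 nat) set \<Rightarrow> ('v, 'k::field) mpoly \<Rightarrow> ('v, 'k) mpoly"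
  where "restrict_exponents T f =
    (\<Sum>m\<in>Poly_Mapping.keys f \<inter> T. Poly_Mapping.single m (Poly_Mapping.lookup f m))"

lemma lookup_restrict_exponents:
  "Poly_Mapping.lookup (restrict_exponents T f) m = (if m \<in> T then Poly_Mapping.lookup f m else 0)"
  by (auto simp: restrict_exponents_def lookup_sum lookup_single when_def sum.delta' in_keys_iff)

lemma restrict_exponents_sum:
  "restrict_exponents T (sum f A) = (\<Sum>x\<in>A. restrict_exponents T (f x))"
  by (intro poly_mapping_eqI) (simp add: lookup_sum lookup_restrict_exponents)

lemma restrict_exponents_id:
  assumes "Poly_Mapping.keys f \<subseteq> T"
  shows "restrict_exponents T f = f"
  using assms by (intro poly_mapping_eqI) (auto simp: lookup_restrict_exponents in_keys_iff)

lemma restrict_exponents_single: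
  "restrict_exponents T (Poly_Mapping.single m c) = (if m \<in> T then Poly_Mapping.single m c else 0)"
  by (intro poly_mapping_eqI) (auto simp: lookup_restrict_exponents lookup_single when_def)

text \<open>The three projections above interact with products in the same way, because each of the three
  sets \<open>T\<close> can be tested on the two summands of an exponent separately; for a degree this holds once
  the first factor is homogeneous.\<close>

lemma restrict_exponents_mult:
  assumes T: "\<And>m m'. m \<in> Poly_Mapping.keys f \<Longrightarrow> m + m' \<in> T \<longleftrightarrow> m \<in> T1 \<and> m' \<in> T2"
  shows "restrict_exponents T (f * g) = restrict_exponents T1 f * restrict_exponents T2 g"
proof -
  let ?s = "\<lambda>f m. Poly_Mapping.single m (Poly_Mapping.lookup f m)"
  have mono: "restrict_exponents T (?s f m * ?s g m') =
      restrict_exponents T1 (?s f m) * restrict_exponents T2 (?s g m')"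
    if "m \<in> Poly_Mapping.keys f" for m m'
    using T[OF that] by (auto simp: mult_single restrict_exponents_single)
  have f': "f = (\<Sum>m\<in>Poly_Mapping.keys f. ?s f m)"
    and g': "g = (\<Sum>m\<in>Poly_Mapping.keys g. ?s g m)"
    by (rule poly_as_sum_of_monomials)+
  have "f * g = (\<Sum>m\<in>Poly_Mapping.keys f. \<Sum>m'\<in>Poly_Mapping.keys g. ?s f m * ?s g m')"
    by (subst (1) f', subst (1) g') (simp add: sum_product)
  then have "restrict_exponents T (f * g) =
      (\<Sum>m\<in>Poly_Mapping.keys f. \<Sum>m'\<in>Poly_Mapping.keys g.
         restrict_exponents T1 (?s f m) * restrict_exponents T2 (?s g m'))"
    by (simp add: restrict_exponents_sum mono)
  also have "\<dots> = restrict_exponents T1 (\<Sum>m\<in>Poly_Mapping.keys f. ?s f m) *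
      restrict_exponents T2 (\<Sum>m\<in>Poly_Mapping.keys g. ?s g m)"
    by (simp add: restrict_exponents_sum sum_product)
  finally show ?thesis using f' g' by simp
qed

lemma exponent_add_eq_0_iff: "(m + n = 0) = (m = 0 \<and> n = (0 :: 'v \<Rightarrow>\<^sub>0 nat))"
  by (auto simp: poly_mapping_eq_iff plus_poly_mapping.rep_eq fun_eq_iff)

lemma const_coeff_mult:
  "Poly_Mapping.lookup (f * g) 0 = Poly_Mapping.lookup f 0 * Poly_Mapping.lookup (g :: ('v, 'k::field) mpoly) 0"
proof -
  have const: "restrict_exponents {0} h = Poly_Mapping.single 0 (Poly_Mapping.lookup h 0)"
    for h :: "('v, 'k) mpoly"
    by (intro poly_mapping_eqI) (simp add: lookup_restrict_exponents lookup_single when_def)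
  have "restrict_exponents {0} (f * g) = restrict_exponents {0} f * restrict_exponents {0} g"
    by (rule restrict_exponents_mult) (simp add: exponent_add_eq_0_iff)
  then have "Poly_Mapping.single (0 :: 'v \<Rightarrow>\<^sub>0 nat) (Poly_Mapping.lookup (f * g) 0) =
      Poly_Mapping.single 0 (Poly_Mapping.lookup f 0 * Poly_Mapping.lookup g 0)"
    by (simp add: const mult_single)
  then show ?thesis by (metis lookup_single_eq)
qed

lemma exponent_split_variable:
  assumes "Poly_Mapping.lookup m v \<noteq> (0::nat)"
  shows "m = Poly_Mapping.single v 1 + (m - Poly_Mapping.single v 1)"
  using assms by (intro poly_mapping_eqI) (auto simp: lookup_add lookup_minus lookup_single when_def)

lemma lookup_mult_single_add:
  "Poly_Mapping.lookup (f * Poly_Mapping.single n c) (m + n) = Poly_Mapping.lookup f m * (c::'k::field)"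
  for m n :: "'v \<Rightarrow>\<^sub>0 nat"
proof -
  have "f * Poly_Mapping.single n c =
      (\<Sum>m\<in>Poly_Mapping.keys f. Poly_Mapping.single (m + n) (Poly_Mapping.lookup f m * c))"
    by (subst (1) poly_as_sum_of_monomials) (simp add: sum_distrib_right mult_single)
  then show ?thesis
    by (simp add: lookup_sum lookup_single when_def in_keys_iff)
qed

lemma mult_monomial_eq_0:
  assumes "f * Poly_Mapping.single n (1::'k::field) = 0"
  shows "f = (0 :: ('v, 'k) mpoly)"
  using lookup_mult_single_add[of f n 1] assms by (intro poly_mapping_eqI) simp

lemma X_dvd_if:
  assumes "\<And>m. m \<in> Poly_Mapping.keys f \<Longrightarrow> Poly_Mapping.lookup m v \<noteq> 0"
  shows "\<exists>x. f = x * (X v :: ('v, 'k::field) mpoly)"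
proof -
  let ?e = "Poly_Mapping.single v 1 :: 'v \<Rightarrow>\<^sub>0 nat"
  have "f = (\<Sum>m\<in>Poly_Mapping.keys f. Poly_Mapping.single m (Poly_Mapping.lookup f m))"
    by (rule poly_as_sum_of_monomials)
  also have "\<dots> = (\<Sum>m\<in>Poly_Mapping.keys f. Poly_Mapping.single (m - ?e) (Poly_Mapping.lookup f m) * X v)"
    using exponent_split_variable[OF assms]
    by (intro sum.cong) (simp_all add: X_def mult_single add.commute)
  also have "\<dots> = (\<Sum>m\<in>Poly_Mapping.keys f. Poly_Mapping.single (m - ?e) (Poly_Mapping.lookup f m)) * X v"
    by (simp add: sum_distrib_right)
  finally show ?thesis by blast
qed

lemma mono_degree_single: "mono_degree (Poly_Mapping.single v n) = n"
  by (simp add: mono_degree_def lookup_single when_def)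

lemma single_in_irrelevant_ideal:
  assumes "mono_degree m \<noteq> 0"
  shows "Poly_Mapping.single m (c::'k::field) \<in> irrelevant_ideal"
proof -
  obtain v where "Poly_Mapping.lookup m v \<noteq> 0"
    using assms sum.not_neutral_contains_not_neutral unfolding mono_degree_def by blast
  from exponent_split_variable[OF this]
  have "Poly_Mapping.single m c = Poly_Mapping.single (m - Poly_Mapping.single v 1) c * X v"
    by (simp add: X_def mult_single add.commute)
  also have "\<dots> \<in> irrelevant_ideal"
    unfolding irrelevant_ideal_def by (intro ideal.span_scale ideal.span_base) simp
  finally show ?thesis .
qed

lemma irrelevant_const_coeff:
  assumes "f \<in> irrelevant_ideal"
  shows "Poly_Mapping.lookup f 0 = (0 :: 'k::field)"
  using assms unfolding irrelevant_ideal_def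
proof (induction rule: ideal.span_induct_alt)
  case (step c x y)
  then show ?case
    by (auto simp: lookup_add const_coeff_mult X_def lookup_single when_def poly_mapping_eq_iff
          fun_eq_iff single.rep_eq split: if_splits)
qed simp

section \<open>Matrices over a ring\<close>

text \<open>Bases of graded modules are indexed as in resolutions: the first component of an index is the
  degree of the basis element.\<close>

definition graded_matrix ::
    "(nat \<times> nat) set \<Rightarrow> (nat \<times> nat) set \<Rightarrow> (nat \<times> nat \<Rightarrow> nat \<times> nat \<Rightarrow> ('v::finite, 'k::field) mpoly) \<Rightarrow> bool"
  where "graded_matrix B C M \<longleftrightarrow>
    (\<forall>p\<in>B. \<forall>q\<in>C. \<forall>m\<in>Poly_Mapping.keys (M p q). mono_degree m + fst p = fst q)"

definition unit_vec :: "'b \<Rightarrow> 'b \<Rightarrow> 'a::comm_ring_1"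
  where "unit_vec q = (\<lambda>p. if p = q then 1 else 0)"

lemma unit_vec_in_free_module: "q \<in> B \<Longrightarrow> unit_vec q \<in> free_module B"
  by (auto simp: free_module_def unit_vec_def)

lemma mat_map_in_free_module [simp]: "mat_map B C M v \<in> free_module B"
  by (simp add: mat_map_def free_module_def)

lemma mat_map_unit_vec:
  assumes "finite C" "q \<in> C"
  shows "mat_map B C M (unit_vec q) = (\<lambda>p. if p \<in> B then M p q else 0)"
  using assms by (simp add: mat_map_def unit_vec_def if_distrib sum.delta' cong: if_cong)

lemma mat_map_mat_map:
  "mat_map A B M (mat_map B C N v) = mat_map A C (\<lambda>p q. \<Sum>r\<in>B. M p r * N r q) v"
proof
  fix p
  have "(\<Sum>r\<in>B. M p r * (\<Sum>q\<in>C. N r q * v q)) = (\<Sum>r\<in>B. \<Sum>q\<in>C. M p r * N r q * v q)"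
    by (simp add: sum_distrib_left)
  also have "\<dots> = (\<Sum>q\<in>C. (\<Sum>r\<in>B. M p r * N r q) * v q)"
    by (subst sum.swap) (simp add: sum_distrib_right)
  finally show "mat_map A B M (mat_map B C N v) p =
      mat_map A C (\<lambda>p q. \<Sum>r\<in>B. M p r * N r q) v p"
    by (simp add: mat_map_def)
qed

lemma mat_map_cong:
  assumes "\<And>p q. p \<in> B \<Longrightarrow> q \<in> C \<Longrightarrow> M p q = N p q"
  shows "mat_map B C M v = mat_map B C N v"
  using assms by (auto simp: mat_map_def intro!: sum.cong ext)

lemma mat_map_zero [simp]: "mat_map B C M (\<lambda>_. 0) = (\<lambda>_. 0)"
  by (auto simp: mat_map_def)

lemma mat_map_add: "mat_map B C M (\<lambda>p. v p + w p) = (\<lambda>p. mat_map B C M v p + mat_map B C M w p)"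
  by (auto simp: mat_map_def ring_distribs sum.distrib)

lemma mat_map_diff: "mat_map B C M (\<lambda>p. v p - w p) = (\<lambda>p. mat_map B C M v p - mat_map B C M w p)"
  by (auto simp: mat_map_def right_diff_distrib sum_subtractf)

lemma mat_map_diff_matrix:
  "mat_map B C (\<lambda>p q. M p q - N p q) v = (\<lambda>p. mat_map B C M v p - mat_map B C N v p)"
  by (auto simp: mat_map_def left_diff_distrib sum_subtractf)

lemma mat_map_id:
  assumes "finite B" "v \<in> free_module B"
  shows "mat_map B B (\<lambda>p q. if p = q then 1 else 0) v = v"
proof
  fix p
  have "(\<Sum>q\<in>B. (if p = q then 1 else 0) * v q) = (\<Sum>q\<in>B. if p = q then v q else 0)"
    by (intro sum.cong) auto
  then show "mat_map B B (\<lambda>p q. if p = q then 1 else 0) v p = v p"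
    using assms by (auto simp: mat_map_def free_module_def)
qed

text \<open>A map out of a free module can be lifted through a matrix one column at a time.\<close>

lemma matrix_lift:
  assumes "\<forall>q\<in>E. (\<lambda>p. if p \<in> B then W p q else 0) \<in> mat_map B C D ` free_module C"
  shows "\<exists>Y. \<forall>p\<in>B. \<forall>q\<in>E. (\<Sum>r\<in>C. D p r * Y r q) = W p q"
proof -
  have "\<exists>y. \<forall>p\<in>B. (\<Sum>r\<in>C. D p r * y r) = W p q" if q: "q \<in> E" for q
  proof -
    obtain y where y: "(\<lambda>p. if p \<in> B then W p q else 0) = mat_map B C D y"
      using assms q by blast
    have "(\<Sum>r\<in>C. D p r * y r) = W p q" if "p \<in> B" for p
      using fun_cong[OF y, of p] that by (simp add: mat_map_def)
    then show ?thesis by blast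
  qed
  then obtain Y where "\<And>q. q \<in> E \<Longrightarrow> \<forall>p\<in>B. (\<Sum>r\<in>C. D p r * Y q r) = W p q" by metis
  then show ?thesis by (intro exI[of _ "\<lambda>r q. Y q r"]) auto
qed

text \<open>Replacing the entries of a lift by their homogeneous components of the expected degrees changes
  nothing, because both \<open>D\<close> and \<open>W\<close> are homogeneous.\<close>

lemma graded_matrix_lift:
  fixes D W :: "nat \<times> nat \<Rightarrow> nat \<times> nat \<Rightarrow> ('v::finite, 'k::field) mpoly"
  assumes D: "graded_matrix B C D" and W: "graded_matrix B E W"
    and im: "\<forall>q\<in>E. (\<lambda>p. if p \<in> B then W p q else 0) \<in> mat_map B C D ` free_module C"
  shows "\<exists>Y. graded_matrix C E Y \<and> (\<forall>p\<in>B. \<forall>q\<in>E. (\<Sum>r\<in>C. D p r * Y r q) = W p q)"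
proof -
  obtain Y where Y: "\<forall>p\<in>B. \<forall>q\<in>E. (\<Sum>r\<in>C. D p r * Y r q) = W p q"
    using matrix_lift[OF im] ..
  let ?deg = "\<lambda>p q. restrict_exponents {m :: 'v \<Rightarrow>\<^sub>0 nat. mono_degree m + fst p = fst q}"
  define Z where "Z r q = ?deg r q (Y r q)" for r q
  have "graded_matrix C E Z"
    by (auto simp: graded_matrix_def Z_def lookup_restrict_exponents in_keys_iff split: if_splits)
  moreover have "(\<Sum>r\<in>C. D p r * Z r q) = W p q" if p: "p \<in> B" and q: "q \<in> E" for p q
  proof -
    have "D p r * Z r q = ?deg p q (D p r * Y r q)" if r: "r \<in> C" for r
    proof -
      have "mono_degree m + fst p = fst r" if "m \<in> Poly_Mapping.keys (D p r)" for m
        using D p r that by (auto simp: graded_matrix_def)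
      then have "?deg p q (D p r * Y r q) = restrict_exponents UNIV (D p r) * ?deg r q (Y r q)"
        by (intro restrict_exponents_mult) force
      then show ?thesis by (simp add: Z_def restrict_exponents_id)
    qed
    then have "(\<Sum>r\<in>C. D p r * Z r q) = ?deg p q (W p q)"
      using Y p q by (simp flip: restrict_exponents_sum)
    also have "\<dots> = W p q"
      by (rule restrict_exponents_id) (use W p q in \<open>auto simp: graded_matrix_def\<close>)
    finally show ?thesis .
  qed
  ultimately show ?thesis by auto
qed

lemma graded_matrix_mult:
  assumes "graded_matrix A B M" "graded_matrix B C N"
  shows "graded_matrix A C (\<lambda>p q. \<Sum>r\<in>B. M p r * N r q)"
  unfolding graded_matrix_def
proof (intro ballI)
  fix p q m
  assume p: "p \<in> A" and q: "q \<in> C" and "m \<in> Poly_Mapping.keys (\<Sum>r\<in>B. M p r * N r q)"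
  then obtain r where r: "r \<in> B" "m \<in> Poly_Mapping.keys (M p r * N r q)"
    using keys_sum[of "\<lambda>r. M p r * N r q" B] by blast
  then obtain m1 m2 where "m = m1 + m2" "m1 \<in> Poly_Mapping.keys (M p r)" "m2 \<in> Poly_Mapping.keys (N r q)"
    using keys_mult[of "M p r" "N r q"] by blast
  then show "mono_degree m + fst p = fst q"
    using assms p q r(1) by (fastforce simp: graded_matrix_def)
qed

section \<open>Uniqueness of graded Betti numbers\<close>

definition differential where
  "differential b M i = mat_map (res_basis b i) (res_basis b (Suc i)) (M (Suc i))"

text \<open>Exactness makes the boundaries equal to the cycles in positive positions, and to the given ideal
  in position \<open>0\<close>. Speaking of boundaries allows all positions to be treated alike.\<close>

definition boundaries where
  "boundaries b M i = differential b M i ` free_module (res_basis b (Suc i))"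

lemma resolutionD:
  assumes "minimal_graded_resolution I b M"
  shows "finite (res_basis b i)"
    and "res_basis b 0 = {(0, 0)}"
    and "graded_matrix (res_basis b i) (res_basis b (Suc i)) (M (Suc i))"
    and "p \<in> res_basis b i \<Longrightarrow> q \<in> res_basis b (Suc i) \<Longrightarrow> M (Suc i) p q \<in> irrelevant_ideal"
    and "boundaries b M 0 = {v \<in> free_module (res_basis b 0). v (0, 0) \<in> I}"
    and "boundaries b M (Suc i) = {v \<in> free_module (res_basis b (Suc i)). differential b M i v = (\<lambda>_. 0)}"
proof -
  note res = assms[unfolded minimal_graded_resolution_def]
  note fin = res[THEN conjunct1] and res = res[THEN conjunct2]
  note zero = res[THEN conjunct1] and res = res[THEN conjunct2]
  note hom = res[THEN conjunct1] and res = res[THEN conjunct2]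
  note bd = res[THEN conjunct1] res[THEN conjunct2]
  show "finite (res_basis b i)" using fin by (rule spec)
  show "res_basis b 0 = {(0, 0)}" using zero by (auto simp: res_basis_def split: if_splits)
  show "graded_matrix (res_basis b i) (res_basis b (Suc i)) (M (Suc i))"
    unfolding graded_matrix_def using hom by simp
  show "M (Suc i) p q \<in> irrelevant_ideal" if "p \<in> res_basis b i" "q \<in> res_basis b (Suc i)"
    using hom that by simp
  show "boundaries b M 0 = {v \<in> free_module (res_basis b 0). v (0, 0) \<in> I}"
    using bd(1) by (simp add: boundaries_def differential_def)
  show "boundaries b M (Suc i) = {v \<in> free_module (res_basis b (Suc i)). differential b M i v = (\<lambda>_. 0)}"
    unfolding boundaries_def differential_def using bd(2) by (rule spec)
qed

text \<open>The map is built position by position. What must be carried along is that it sends boundaries to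
  boundaries: this is what makes the next lift possible.\<close>

lemma comparison_map:
  fixes M M' :: "nat \<Rightarrow> nat \<times> nat \<Rightarrow> nat \<times> nat \<Rightarrow> ('v::finite, 'k::field) mpoly"
  assumes R: "minimal_graded_resolution I b M" and R': "minimal_graded_resolution I b' M'"
  shows "\<exists>\<Phi>. (\<forall>n. graded_matrix (res_basis b' n) (res_basis b n) (\<Phi> n)) \<and>
    (\<forall>n. \<forall>v\<in>free_module (res_basis b (Suc n)).
       differential b' M' n (mat_map (res_basis b' (Suc n)) (res_basis b (Suc n)) (\<Phi> (Suc n)) v) =
         mat_map (res_basis b' n) (res_basis b n) (\<Phi> n) (differential b M n v)) \<and>
    (\<forall>v\<in>free_module (res_basis b 0). mat_map (res_basis b' 0) (res_basis b 0) (\<Phi> 0) v = v)"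
proof -
  let ?B = "res_basis b" and ?B' = "res_basis b'"
  define P :: "nat \<Rightarrow> (nat \<times> nat \<Rightarrow> nat \<times> nat \<Rightarrow> ('v, 'k) mpoly) \<Rightarrow> bool" where
    "P n F \<longleftrightarrow> graded_matrix (?B' n) (?B n) F \<and>
       (\<forall>w\<in>boundaries b M n. mat_map (?B' n) (?B n) F w \<in> boundaries b' M' n) \<and>
       (n = 0 \<longrightarrow> (\<forall>v\<in>free_module (?B 0). mat_map (?B' 0) (?B 0) F v = v))" for n F
  define Q :: "nat \<Rightarrow> (nat \<times> nat \<Rightarrow> nat \<times> nat \<Rightarrow> ('v, 'k) mpoly) \<Rightarrow> (nat \<times> nat \<Rightarrow> nat \<times> nat \<Rightarrow> ('v, 'k) mpoly) \<Rightarrow> bool" where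
    "Q n F G \<longleftrightarrow> (\<forall>v\<in>free_module (?B (Suc n)).
       differential b' M' n (mat_map (?B' (Suc n)) (?B (Suc n)) G v) =
       mat_map (?B' n) (?B n) F (differential b M n v))" for n F G
  have "P 0 (\<lambda>p q. if p = q then 1 else 0)"
  proof -
    have id: "mat_map (?B' 0) (?B 0) (\<lambda>p q. if p = q then 1 else 0) v = v"
      if "v \<in> free_module (?B 0)" for v :: "_ \<Rightarrow> ('v, 'k) mpoly"
      using mat_map_id[OF resolutionD(1)[OF R, of 0] that] by (simp add: resolutionD(2)[OF R] resolutionD(2)[OF R'])
    moreover have "boundaries b M 0 = boundaries b' M' 0"
      by (simp add: resolutionD(2,5)[OF R] resolutionD(2,5)[OF R'])
    moreover have "boundaries b M 0 \<subseteq> free_module (?B 0)"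
      by (auto simp: boundaries_def differential_def)
    moreover have "graded_matrix (?B' 0) (?B 0) (\<lambda>p q. if p = q then 1 else 0 :: ('v, 'k) mpoly)"
      by (simp add: graded_matrix_def resolutionD(2)[OF R] resolutionD(2)[OF R'] mono_degree_def)
    ultimately show ?thesis unfolding P_def by auto
  qed
  moreover have "\<exists>G. P (Suc n) G \<and> Q n F G" if F: "P n F" for F n
  proof -
    define W where "W p q = (\<Sum>r\<in>?B n. F p r * M (Suc n) r q)" for p q
    have W: "graded_matrix (?B' n) (?B (Suc n)) W"
      unfolding W_def
      by (rule graded_matrix_mult) (use F resolutionD(3)[OF R] in \<open>auto simp: P_def\<close>)
    have F_diff: "mat_map (?B' n) (?B n) F (differential b M n v) = mat_map (?B' n) (?B (Suc n)) W v" for v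
      unfolding W_def differential_def mat_map_mat_map ..
    have "\<forall>q\<in>?B (Suc n). (\<lambda>p. if p \<in> ?B' n then W p q else 0) \<in>
        mat_map (?B' n) (?B' (Suc n)) (M' (Suc n)) ` free_module (?B' (Suc n))"
    proof
      fix q assume q: "q \<in> ?B (Suc n)"
      have "differential b M n (unit_vec q) \<in> boundaries b M n"
        using unit_vec_in_free_module[OF q] by (auto simp: boundaries_def)
      then have "mat_map (?B' n) (?B (Suc n)) W (unit_vec q) \<in> boundaries b' M' n"
        using F by (auto simp: P_def simp flip: F_diff)
      then show "(\<lambda>p. if p \<in> ?B' n then W p q else 0) \<in>
          mat_map (?B' n) (?B' (Suc n)) (M' (Suc n)) ` free_module (?B' (Suc n))"
        by (simp add: mat_map_unit_vec resolutionD(1)[OF R] q boundaries_def differential_def)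
    qed
    from graded_matrix_lift[OF resolutionD(3)[OF R'] W this]
    obtain G where G: "graded_matrix (?B' (Suc n)) (?B (Suc n)) G"
      and lift: "\<forall>p\<in>?B' n. \<forall>q\<in>?B (Suc n). (\<Sum>r\<in>?B' (Suc n). M' (Suc n) p r * G r q) = W p q"
      by (elim exE conjE)
    have comm: "differential b' M' n (mat_map (?B' (Suc n)) (?B (Suc n)) G v) =
        mat_map (?B' n) (?B n) F (differential b M n v)" for v
      unfolding F_diff unfolding differential_def mat_map_mat_map by (rule mat_map_cong) (use lift in simp)
    have "mat_map (?B' (Suc n)) (?B (Suc n)) G w \<in> boundaries b' M' (Suc n)"
      if w: "w \<in> boundaries b M (Suc n)" for w
    proof -
      have "differential b M n w = (\<lambda>_. 0)" using w by (simp add: resolutionD(6)[OF R])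
      then have "differential b' M' n (mat_map (?B' (Suc n)) (?B (Suc n)) G w) = (\<lambda>_. 0)"
        by (simp add: comm)
      then show ?thesis by (simp add: resolutionD(6)[OF R'])
    qed
    then show ?thesis using G comm unfolding P_def Q_def by (intro exI[of _ G]) auto
  qed
  ultimately obtain \<Phi> where "\<forall>n. P n (\<Phi> n) \<and> Q n (\<Phi> n) (\<Phi> (Suc n))"
    using dependent_nat_choice[of P Q] by blast
  then have P: "P n (\<Phi> n)" and Q: "Q n (\<Phi> n) (\<Phi> (Suc n))" for n by simp_all
  show ?thesis
    using P[unfolded P_def] Q[unfolded Q_def] by (intro exI[of _ \<Phi>] conjI allI) simp_all
qed

text \<open>A chain endomorphism \<open>\<Theta>\<close> that vanishes in position \<open>0\<close> is null-homotopic: one finds matrices \<open>H\<close>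
  with \<open>\<Theta> = d H + H d\<close>. All entries of the right-hand side lie in the irrelevant ideal, since those
  of \<open>d\<close> do.\<close>

lemma null_homotopic_const_coeff:
  fixes M :: "nat \<Rightarrow> nat \<times> nat \<Rightarrow> nat \<times> nat \<Rightarrow> ('v::finite, 'k::field) mpoly"
  assumes R: "minimal_graded_resolution I b M"
    and chain: "\<And>n v. v \<in> free_module (res_basis b (Suc n)) \<Longrightarrow>
       differential b M n (mat_map (res_basis b (Suc n)) (res_basis b (Suc n)) (\<Theta> (Suc n)) v) =
         mat_map (res_basis b n) (res_basis b n) (\<Theta> n) (differential b M n v)"
    and zero: "\<And>v. v \<in> free_module (res_basis b 0) \<Longrightarrow>
       mat_map (res_basis b 0) (res_basis b 0) (\<Theta> 0) v = (\<lambda>_. 0)"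
    and pq: "p \<in> res_basis b n" "q \<in> res_basis b n"
  shows "Poly_Mapping.lookup (\<Theta> n p q) 0 = 0"
proof -
  let ?B = "res_basis b"
  \<comment> \<open>\<open>P n H\<close> is the invariant for choosing \<open>H\<close> in position \<open>n\<close>: on boundaries \<open>\<Theta>\<close> equals \<open>d H\<close>. \<open>Q n H H'\<close>
    is the homotopy equation \<open>\<Theta> = d H' + H d\<close> in position \<open>Suc n\<close>.\<close>
  define P :: "nat \<Rightarrow> (nat \<times> nat \<Rightarrow> nat \<times> nat \<Rightarrow> ('v, 'k) mpoly) \<Rightarrow> bool" where
    "P n H \<longleftrightarrow> (\<forall>w\<in>boundaries b M n.
       mat_map (?B n) (?B n) (\<Theta> n) w = differential b M n (mat_map (?B (Suc n)) (?B n) H w))" for n H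
  define Q :: "nat \<Rightarrow> (nat \<times> nat \<Rightarrow> nat \<times> nat \<Rightarrow> ('v, 'k) mpoly) \<Rightarrow> (nat \<times> nat \<Rightarrow> nat \<times> nat \<Rightarrow> ('v, 'k) mpoly) \<Rightarrow> bool" where
    "Q n H H' \<longleftrightarrow> (\<forall>p\<in>?B (Suc n). \<forall>q\<in>?B (Suc n). \<Theta> (Suc n) p q =
       (\<Sum>r\<in>?B (Suc (Suc n)). M (Suc (Suc n)) p r * H' r q) + (\<Sum>r\<in>?B n. H p r * M (Suc n) r q))" for n H H'
  have bd: "boundaries b M n \<subseteq> free_module (?B n)" for n
    by (auto simp: boundaries_def differential_def)
  have "P 0 (\<lambda>_ _. 0)"
    using zero bd[of 0] unfolding P_def differential_def by (force simp: mat_map_def)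
  moreover have "\<exists>H'. P (Suc n) H' \<and> Q n H H'" if H: "P n H" for H n
  proof -
    \<comment> \<open>The part of \<open>\<Theta>\<close> not yet accounted for by \<open>H d\<close> maps into cycles, so it lifts through \<open>d\<close>.\<close>
    define V where "V p q = (\<Sum>r\<in>?B n. H p r * M (Suc n) r q)" for p q
    define W where "W p q = \<Theta> (Suc n) p q - V p q" for p q
    have V: "mat_map (?B (Suc n)) (?B (Suc n)) V v =
        mat_map (?B (Suc n)) (?B n) H (differential b M n v)" for v
      unfolding V_def differential_def mat_map_mat_map ..
    have W: "mat_map (?B (Suc n)) (?B (Suc n)) W v \<in> boundaries b M (Suc n)"
      if v: "v \<in> free_module (?B (Suc n))" for v
    proof -
      have "differential b M n v \<in> boundaries b M n" using v by (simp add: boundaries_def)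
      then have "mat_map (?B n) (?B n) (\<Theta> n) (differential b M n v) =
          differential b M n (mat_map (?B (Suc n)) (?B n) H (differential b M n v))"
        using H unfolding P_def by blast
      then have "differential b M n (mat_map (?B (Suc n)) (?B (Suc n)) W v) = (\<lambda>_. 0)"
        unfolding W_def mat_map_diff_matrix V
        by (subst differential_def, subst mat_map_diff) (simp add: chain[OF v] flip: differential_def)
      then show ?thesis by (simp add: resolutionD(6)[OF R])
    qed
    have "\<forall>q\<in>?B (Suc n). (\<lambda>p. if p \<in> ?B (Suc n) then W p q else 0) \<in>
        mat_map (?B (Suc n)) (?B (Suc (Suc n))) (M (Suc (Suc n))) ` free_module (?B (Suc (Suc n)))"
    proof
      fix q assume q: "q \<in> ?B (Suc n)"
      show "(\<lambda>p. if p \<in> ?B (Suc n) then W p q else 0) \<in>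
          mat_map (?B (Suc n)) (?B (Suc (Suc n))) (M (Suc (Suc n))) ` free_module (?B (Suc (Suc n)))"
        using W[OF unit_vec_in_free_module[OF q]]
        by (simp add: mat_map_unit_vec resolutionD(1)[OF R] q boundaries_def differential_def)
    qed
    from matrix_lift[OF this]
    obtain H' where H': "\<forall>p\<in>?B (Suc n). \<forall>q\<in>?B (Suc n).
        (\<Sum>r\<in>?B (Suc (Suc n)). M (Suc (Suc n)) p r * H' r q) = W p q" ..
    have "Q n H H'" using H' by (simp add: Q_def W_def V_def)
    moreover have "P (Suc n) H'"
      unfolding P_def
    proof
      fix w assume w: "w \<in> boundaries b M (Suc n)"
      then have "differential b M n w = (\<lambda>_. 0)" by (simp add: resolutionD(6)[OF R])
      then have "mat_map (?B (Suc n)) (?B (Suc n)) V w = (\<lambda>_. 0)"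
        by (simp add: V)
      moreover have "differential b M (Suc n) (mat_map (?B (Suc (Suc n))) (?B (Suc n)) H' w) =
          mat_map (?B (Suc n)) (?B (Suc n)) W w"
        unfolding differential_def mat_map_mat_map by (rule mat_map_cong) (use H' in simp)
      ultimately show "mat_map (?B (Suc n)) (?B (Suc n)) (\<Theta> (Suc n)) w =
          differential b M (Suc n) (mat_map (?B (Suc (Suc n))) (?B (Suc n)) H' w)"
        unfolding W_def mat_map_diff_matrix by simp
    qed
    ultimately show ?thesis by blast
  qed
  ultimately obtain \<H> where \<H>: "\<forall>n. P n (\<H> n) \<and> Q n (\<H> n) (\<H> (Suc n))"
    using dependent_nat_choice[of P Q] by blast
  show ?thesis
  proof (cases n)
    case 0
    have "mat_map (?B 0) (?B 0) (\<Theta> 0) (unit_vec q) p = 0"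
      using zero[OF unit_vec_in_free_module] pq 0 by simp
    then show ?thesis using pq 0 by (simp add: mat_map_unit_vec resolutionD(1)[OF R])
  next
    case (Suc k)
    have const: "Poly_Mapping.lookup (M (Suc i) p q) 0 = 0" if "p \<in> ?B i" "q \<in> ?B (Suc i)" for i p q
      using irrelevant_const_coeff[OF resolutionD(4)[OF R that]] .
    have "\<Theta> (Suc k) p q = (\<Sum>r\<in>?B (Suc (Suc k)). M (Suc (Suc k)) p r * \<H> (Suc k) r q) +
        (\<Sum>r\<in>?B k. \<H> k p r * M (Suc k) r q)"
      using \<H> pq Suc unfolding Q_def by blast
    then show ?thesis
      using pq Suc by (simp add: lookup_add lookup_sum const_coeff_mult const)
  qed
qed

lemma function_vector_space: "vector_space (\<lambda>(c::'k::field) (f::'c \<Rightarrow> 'k) x. c * f x)"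
  by (rule vector_space.intro)
    (simp_all add: fun_eq_iff distrib_left distrib_right)

text \<open>The unit vectors indexed by \<open>A\<close> are linearly independent, and the hypothesis writes each of them
  as a combination of the rows of \<open>F\<close>.\<close>

lemma card_le_if_left_inverse:
  fixes F :: "'b \<Rightarrow> 'c \<Rightarrow> 'k::field"
  assumes A: "finite A" and B: "finite B"
    and id: "\<And>p q. p \<in> A \<Longrightarrow> q \<in> A \<Longrightarrow> (\<Sum>r\<in>B. G p r * F r q) = (if p = q then 1 else 0)"
  shows "card A \<le> card B"
proof -
  interpret vector_space "\<lambda>(c::'k) (f::'c \<Rightarrow> 'k) x. c * f x"
    by (rule function_vector_space)
  let ?row = "\<lambda>r q. if q \<in> A then F r q else 0"
  have sum_apply: "sum f X q = (\<Sum>x\<in>X. f x q)" for f :: "'d \<Rightarrow> 'c \<Rightarrow> 'k" and X q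
    by (induction X rule: infinite_finite_induct) auto
  have in_span: "unit_vec ` A \<subseteq> span (?row ` B)"
  proof
    fix e :: "'c \<Rightarrow> 'k" assume "e \<in> unit_vec ` A"
    then obtain p where p: "p \<in> A" and e: "e = unit_vec p" by blast
    have "e = (\<Sum>r\<in>B. (\<lambda>q. G p r * ?row r q))"
    proof
      fix q show "e q = (\<Sum>r\<in>B. (\<lambda>q. G p r * ?row r q)) q"
        using p id[of p q] by (cases "q \<in> A") (auto simp: e sum_apply unit_vec_def)
    qed
    also have "\<dots> \<in> span (?row ` B)"
      by (intro span_sum span_scale[where x = "?row _"] span_base) auto
    finally show "e \<in> span (?row ` B)" .
  qed
  have inj: "inj_on (unit_vec :: 'c \<Rightarrow> 'c \<Rightarrow> 'k) A"
    by (auto simp: inj_on_def unit_vec_def fun_eq_iff split: if_splits)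
  have "independent (unit_vec ` A :: ('c \<Rightarrow> 'k) set)"
  proof (rule independent_if_scalars_zero)
    fix f :: "('c \<Rightarrow> 'k) \<Rightarrow> 'k" and x :: "'c \<Rightarrow> 'k"
    assume sum: "(\<Sum>x\<in>unit_vec ` A. (\<lambda>q. f x * x q)) = 0" and "x \<in> unit_vec ` A"
    then obtain p where p: "p \<in> A" and x: "x = unit_vec p" by blast
    have "(\<Sum>q\<in>A. (\<lambda>p. f (unit_vec q) * unit_vec q p)) = 0"
      using sum by (simp add: sum.reindex[OF inj])
    then have "(\<Sum>q\<in>A. (\<lambda>p. f (unit_vec q) * unit_vec q p)) p = 0" by simp
    then show "f x = 0"
      using p A by (simp add: sum_apply x unit_vec_def if_distrib cong: if_cong)
  qed (use A in simp)
  from independent_span_bound[OF _ this in_span]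
  have "card (unit_vec ` A :: ('c \<Rightarrow> 'k) set) \<le> card (?row ` B)" using B by simp
  then show ?thesis
    using card_image[OF inj] card_image_le[OF B, of ?row] by simp
qed

text \<open>The composition of comparison maps \<open>F \<rightarrow> F' \<rightarrow> F\<close>, minus the identity, is a chain endomorphism that
  vanishes in position \<open>0\<close>. Hence its constant coefficients vanish, and those of the two comparison
  maps in degree \<open>j\<close> are matrices with product the identity.\<close>

lemma betti_le:
  fixes M M' :: "nat \<Rightarrow> nat \<times> nat \<Rightarrow> nat \<times> nat \<Rightarrow> ('v::finite, 'k::field) mpoly"
  assumes R: "minimal_graded_resolution I b M" and R': "minimal_graded_resolution I b' M'"
  shows "b i j \<le> b' i j"
proof -
  let ?B = "res_basis b" and ?B' = "res_basis b'"
  let ?const = "\<lambda>f. Poly_Mapping.lookup f (0 :: 'v \<Rightarrow>\<^sub>0 nat) :: 'k"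
  from comparison_map[OF R R'] obtain \<Phi> where \<Phi>:
    "\<forall>n. graded_matrix (?B' n) (?B n) (\<Phi> n)"
    "\<forall>n. \<forall>v\<in>free_module (?B (Suc n)).
       differential b' M' n (mat_map (?B' (Suc n)) (?B (Suc n)) (\<Phi> (Suc n)) v) =
         mat_map (?B' n) (?B n) (\<Phi> n) (differential b M n v)"
    "\<forall>v\<in>free_module (?B 0). mat_map (?B' 0) (?B 0) (\<Phi> 0) v = v"
    by (elim exE conjE)
  from comparison_map[OF R' R] obtain \<Psi> where \<Psi>:
    "\<forall>n. \<forall>v\<in>free_module (?B' (Suc n)).
       differential b M n (mat_map (?B (Suc n)) (?B' (Suc n)) (\<Psi> (Suc n)) v) =
         mat_map (?B n) (?B' n) (\<Psi> n) (differential b' M' n v)"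
    "\<forall>v\<in>free_module (?B' 0). mat_map (?B 0) (?B' 0) (\<Psi> 0) v = v"
    by (elim exE conjE)
  define \<Theta> where "\<Theta> n p q = (\<Sum>r\<in>?B' n. \<Psi> n p r * \<Phi> n r q) - (if p = q then 1 else 0)" for n p q
  have \<Theta>: "mat_map (?B n) (?B n) (\<Theta> n) v =
      (\<lambda>p. mat_map (?B n) (?B' n) (\<Psi> n) (mat_map (?B' n) (?B n) (\<Phi> n) v) p - v p)"
    if "v \<in> free_module (?B n)" for n v
    unfolding \<Theta>_def mat_map_diff_matrix mat_map_mat_map
    by (simp add: mat_map_id[OF resolutionD(1)[OF R] that])
  have const_zero: "?const (\<Theta> i p q) = 0" if "p \<in> ?B i" "q \<in> ?B i" for p q
  proof (rule null_homotopic_const_coeff[OF R _ _ that])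
    fix v :: "nat \<times> nat \<Rightarrow> ('v, 'k) mpoly" assume v: "v \<in> free_module (?B 0)"
    have "v \<in> free_module (?B' 0)" using v resolutionD(2)[OF R] resolutionD(2)[OF R'] by simp
    then show "mat_map (?B 0) (?B 0) (\<Theta> 0) v = (\<lambda>_. 0)" using v \<Phi>(3) \<Psi>(2) by (simp add: \<Theta>[OF v])
  next
    fix n and v :: "nat \<times> nat \<Rightarrow> ('v, 'k) mpoly" assume v: "v \<in> free_module (?B (Suc n))"
    have dv: "differential b M n v \<in> free_module (?B n)" by (simp add: differential_def)
    have "differential b M n (mat_map (?B (Suc n)) (?B (Suc n)) (\<Theta> (Suc n)) v) =
        (\<lambda>p. differential b M n (mat_map (?B (Suc n)) (?B' (Suc n)) (\<Psi> (Suc n))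
           (mat_map (?B' (Suc n)) (?B (Suc n)) (\<Phi> (Suc n)) v)) p - differential b M n v p)"
      unfolding \<Theta>[OF v] by (simp add: differential_def mat_map_diff)
    then show "differential b M n (mat_map (?B (Suc n)) (?B (Suc n)) (\<Theta> (Suc n)) v) =
        mat_map (?B n) (?B n) (\<Theta> n) (differential b M n v)"
      using v \<Phi>(2) \<Psi>(1) by (simp add: \<Theta>[OF dv])
  qed
  let ?A = "{p \<in> ?B i. fst p = j}" and ?A' = "{p \<in> ?B' i. fst p = j}"
  have fin: "finite ?A" "finite ?A'"
    using resolutionD(1)[OF R] resolutionD(1)[OF R'] by auto
  have inv: "(\<Sum>r\<in>?A'. ?const (\<Psi> i p r) * ?const (\<Phi> i r q)) = (if p = q then 1 else 0)"
    if p: "p \<in> ?A" and q: "q \<in> ?A" for p q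
  proof -
    \<comment> \<open>A homogeneous entry between basis elements of different degrees has no constant term.\<close>
    have zero: "?const (\<Phi> i r q) = 0" if r: "r \<in> ?B' i" "fst r \<noteq> j" for r
    proof (rule ccontr)
      assume "?const (\<Phi> i r q) \<noteq> 0"
      then have "0 \<in> Poly_Mapping.keys (\<Phi> i r q)" by (simp add: in_keys_iff)
      then have "mono_degree (0 :: 'v \<Rightarrow>\<^sub>0 nat) + fst r = fst q"
        using \<Phi>(1) r(1) q unfolding graded_matrix_def by blast
      then show False using q r(2) by (simp add: mono_degree_def)
    qed
    have "(\<Sum>r\<in>?A'. ?const (\<Psi> i p r) * ?const (\<Phi> i r q)) =
        (\<Sum>r\<in>?B' i. ?const (\<Psi> i p r) * ?const (\<Phi> i r q))"
      by (rule sum.mono_neutral_left) (use resolutionD(1)[OF R'] zero in auto)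
    also have "\<dots> = ?const (\<Theta> i p q) + (if p = q then 1 else 0)"
      by (simp add: \<Theta>_def lookup_minus lookup_sum const_coeff_mult)
    finally show ?thesis using const_zero p q by simp
  qed
  have "card ?A \<le> card ?A'" by (rule card_le_if_left_inverse[OF fin inv])
  moreover have "{p \<in> res_basis c i. fst p = j} = {j} \<times> {..<c i j}" for c
    by (auto simp: res_basis_def)
  ultimately show ?thesis by (simp add: card_cartesian_product)
qed

lemma graded_betti_eq:
  assumes "minimal_graded_resolution I b M"
  shows "graded_betti i j I = b i j"
  unfolding graded_betti_def
proof (rule the_equality)
  show "\<exists>b' M. minimal_graded_resolution I b' M \<and> b i j = b' i j"
    by (intro exI[of _ b] exI[of _ M] conjI assms refl)
  fix n assume "\<exists>b' M'. minimal_graded_resolution I b' M' \<and> n = b' i j"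
  then obtain b' M' where R': "minimal_graded_resolution I b' M'" and n: "n = b' i j"
    by (elim exE conjE)
  show "n = b i j"
    unfolding n by (rule le_antisym) (rule betti_le[OF R' assms], rule betti_le[OF assms R'])
qed

section \<open>Monomial ideals\<close>

definition mono_ideal :: "('v \<Rightarrow>\<^sub>0 nat) set \<Rightarrow> ('v, 'k::field) mpoly set"
  where "mono_ideal S = {f. Poly_Mapping.keys f \<subseteq> S}"

lemma in_mono_idealI: "(\<And>m. m \<in> Poly_Mapping.keys f \<Longrightarrow> m \<in> S) \<Longrightarrow> f \<in> mono_ideal S"
  by (auto simp: mono_ideal_def)

lemma single_in_mono_ideal_iff [simp]:
  "Poly_Mapping.single m (1::'k::field) \<in> mono_ideal S \<longleftrightarrow> m \<in> S"
  by (simp add: mono_ideal_def)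

lemma mono_ideal_Inter: "(\<Inter>x\<in>A. mono_ideal (S x)) = mono_ideal (\<Inter>x\<in>A. S x)"
  by (auto simp: mono_ideal_def)

lemma is_ideal_mono_ideal:
  assumes "\<And>m n. m \<in> S \<Longrightarrow> m + n \<in> S"
  shows "is_ideal (mono_ideal S :: ('v, 'k::field) mpoly set)"
proof (rule ideal.subspaceI)
  fix c x y :: "('v, 'k) mpoly"
  assume x: "x \<in> mono_ideal S"
  show "c * x \<in> mono_ideal S"
  proof (rule in_mono_idealI)
    fix m assume "m \<in> Poly_Mapping.keys (c * x)"
    then obtain a b where m: "m = a + b" "b \<in> Poly_Mapping.keys x" using keys_mult[of c x] by blast
    have "b + a \<in> S" by (rule assms) (use m x in \<open>auto simp: mono_ideal_def\<close>)
    then show "m \<in> S" by (simp add: m add.commute)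
  qed
  show "x + y \<in> mono_ideal S" if "y \<in> mono_ideal S"
    using x that keys_add[of x y] by (auto simp: mono_ideal_def)
qed (simp add: mono_ideal_def)

lemma mono_ideal_subset_ideal:
  assumes J: "is_ideal J" and mono: "\<And>m. m \<in> S \<Longrightarrow> Poly_Mapping.single m (1::'k::field) \<in> J"
  shows "mono_ideal S \<subseteq> J"
proof
  fix f :: "('a, 'k) mpoly" assume f: "f \<in> mono_ideal S"
  have "Poly_Mapping.single m (Poly_Mapping.lookup f m) \<in> J" if "m \<in> Poly_Mapping.keys f" for m
  proof -
    have "Poly_Mapping.single 0 (Poly_Mapping.lookup f m) * Poly_Mapping.single m 1 \<in> J"
      by (rule ideal.subspace_scale[OF J]) (use mono f that in \<open>auto simp: mono_ideal_def\<close>)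
    then show ?thesis by (simp add: mult_single)
  qed
  then show "f \<in> J"
    by (subst poly_as_sum_of_monomials) (rule ideal.subspace_sum[OF J])
qed

lemma ideal_gen_monomials:
  "ideal_gen ((\<lambda>m. Poly_Mapping.single m (1::'k::field)) ` G) = mono_ideal {g + n | g n. g \<in> G}"
    (is "_ = mono_ideal ?S")
proof (rule subset_antisym)
  have "is_ideal (mono_ideal ?S :: (_, 'k) mpoly set)"
    by (rule is_ideal_mono_ideal) (force simp: add.assoc)
  moreover have "g \<in> ?S" if "g \<in> G" for g using that by (force intro: exI[of _ 0])
  ultimately show "ideal_gen ((\<lambda>m. Poly_Mapping.single m (1::'k::field)) ` G) \<subseteq> mono_ideal ?S"
    by (intro ideal.span_minimal) auto
  show "mono_ideal ?S \<subseteq> ideal_gen ((\<lambda>m. Poly_Mapping.single m (1::'k::field)) ` G)"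
  proof (rule mono_ideal_subset_ideal)
    fix m assume "m \<in> ?S"
    then obtain g n where m: "m = g + n" and g: "g \<in> G" by blast
    have "Poly_Mapping.single n 1 * Poly_Mapping.single g (1::'k) \<in>
        ideal_gen ((\<lambda>m. Poly_Mapping.single m (1::'k::field)) ` G)"
      by (intro ideal.span_scale ideal.span_base) (use g in simp)
    then show "Poly_Mapping.single m (1::'k) \<in> ideal_gen ((\<lambda>m. Poly_Mapping.single m (1::'k::field)) ` G)"
      by (simp add: mult_single m add.commute)
  qed simp
qed

text \<open>Membership means vanishing of the projection onto the span of \<open>T\<close>. For a face \<open>T\<close> of the monoid of
  exponents this projection is multiplicative, and the polynomial ring has no zero divisors.\<close>

lemma prime_ideal_mono_ideal_Compl:
  fixes T :: "('v::linorder \<Rightarrow>\<^sub>0 nat) set"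
  assumes face: "\<And>m n. m + n \<in> T \<longleftrightarrow> m \<in> T \<and> n \<in> T" and ne: "0 \<in> T"
  shows "prime_ideal (mono_ideal (- T) :: ('v, 'k::field) mpoly set)"
  unfolding prime_ideal_def
proof (intro conjI allI impI)
  show "is_ideal (mono_ideal (- T) :: ('v, 'k) mpoly set)"
    by (rule is_ideal_mono_ideal) (simp add: face)
  have "Poly_Mapping.single 0 (1::'k) \<notin> mono_ideal (- T)" using ne by (simp add: mono_ideal_def)
  then show "mono_ideal (- T) \<noteq> (UNIV :: ('v, 'k) mpoly set)" by blast
  have iff: "f \<in> mono_ideal (- T) \<longleftrightarrow> restrict_exponents T f = 0" for f :: "('v, 'k) mpoly"
    by (auto simp: mono_ideal_def poly_mapping_eq_iff lookup_restrict_exponents fun_eq_iff in_keys_iff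
        split: if_splits)
  fix a b :: "('v, 'k) mpoly"
  assume "a * b \<in> mono_ideal (- T)"
  moreover have "restrict_exponents T (a * b) = restrict_exponents T a * restrict_exponents T b"
    by (rule restrict_exponents_mult) (rule face)
  ultimately show "a \<in> mono_ideal (- T) \<or> b \<in> mono_ideal (- T)" by (simp add: iff)
qed

lemma prime_imp_radical_eq:
  assumes "prime_ideal P"
  shows "radical P = P"
proof
  show "P \<subseteq> radical P" unfolding radical_def by (auto intro: exI[of _ "1 :: nat"])
  show "radical P \<subseteq> P"
  proof
    fix f assume "f \<in> radical P"
    then obtain n where "f ^ n \<in> P" by (auto simp: radical_def)
    then show "f \<in> P" using prime_ideal_prod[OF assms, of "{..<n}" "\<lambda>_. f"] by auto
  qed
qed

lemma prime_imp_primary: "prime_ideal P \<Longrightarrow> primary_ideal P"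
  unfolding primary_ideal_def by (auto simp: prime_imp_radical_eq) (auto simp: prime_ideal_def)

lemma prime_ideal_colon:
  assumes "prime_ideal P" "f \<notin> P"
  shows "g * f \<in> P \<longleftrightarrow> g \<in> P"
proof
  assume "g \<in> P"
  then have "f * g \<in> P"
    using assms(1) ideal.subspace_scale unfolding prime_ideal_def by blast
  then show "g * f \<in> P" by (simp add: mult.commute)
qed (use assms in \<open>auto simp: prime_ideal_def\<close>)

text \<open>If \<open>Q\<close> is the annihilator of \<open>f\<close> modulo an intersection of primes, then \<open>Q\<close> is the intersection of
  those primes that do not contain \<open>f\<close>. Being prime, \<open>Q\<close> contains one of them, and so equals it.\<close>

lemma associated_prime_of_Inter:
  assumes D: "finite D" and prime: "\<And>P. P \<in> D \<Longrightarrow> prime_ideal P"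
    and Q: "Q \<in> associated_primes (\<Inter>D)"
  shows "Q \<in> D"
proof -
  obtain f where Q: "prime_ideal Q" and Qf: "Q = {g. g * f \<in> \<Inter>D}"
    using Q by (auto simp: associated_primes_def)
  define A where "A = {P \<in> D. f \<notin> P}"
  have Q_eq: "Q = \<Inter>A"
  proof -
    have "g * f \<in> P \<longleftrightarrow> f \<in> P \<or> g \<in> P" if "P \<in> D" for g P
      using prime_ideal_colon[OF prime[OF that], of f g] prime[OF that]
        ideal.subspace_scale[of P f g] by (auto simp: prime_ideal_def)
    then show ?thesis by (auto simp: Qf A_def)
  qed
  have "\<exists>P\<in>A. P \<subseteq> Q"
  proof (rule ccontr)
    assume "\<not> (\<exists>P\<in>A. P \<subseteq> Q)"
    then have "\<forall>P\<in>A. \<exists>x. x \<in> P \<and> x \<notin> Q" by blast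
    then obtain h where h: "\<forall>P\<in>A. h P \<in> P \<and> h P \<notin> Q" by (rule bchoice[THEN exE])
    have fin: "finite A" using D by (simp add: A_def)
    have "prod h A \<in> P" if "P \<in> A" for P
    proof -
      have "is_ideal P" using that prime by (auto simp: A_def prime_ideal_def)
      then have "prod h (A - {P}) * h P \<in> P"
        by (rule ideal.subspace_scale) (use h that in blast)
      then show ?thesis using prod.remove[OF fin that, of h] by (simp add: mult.commute)
    qed
    then have "prod h A \<in> Q" by (simp add: Q_eq)
    moreover have "prod h A \<notin> Q" using prime_ideal_prod[OF Q fin] h by blast
    ultimately show False by blast
  qed
  then obtain P where "P \<in> A" "P \<subseteq> Q" by blast
  moreover from this have "Q \<subseteq> P" by (auto simp: Q_eq)
  ultimately show ?thesis by (auto simp: A_def)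
qed

section \<open>Symbolic powers of the edge ideal of a complete graph\<close>

definition variables_ideal :: "'v set \<Rightarrow> ('v, 'k::field) mpoly set"
  where "variables_ideal A = mono_ideal {m. \<exists>v\<in>A. Poly_Mapping.lookup m v \<noteq> 0}"

lemma prime_ideal_variables_ideal:
  "prime_ideal (variables_ideal A :: ('v::linorder, 'k::field) mpoly set)"
proof -
  have "{m. \<exists>v\<in>A. Poly_Mapping.lookup m v \<noteq> 0} = - {m :: 'v \<Rightarrow>\<^sub>0 nat. \<forall>v\<in>A. Poly_Mapping.lookup m v = 0}"
    by auto
  then show ?thesis
    unfolding variables_ideal_def by (simp only:) (rule prime_ideal_mono_ideal_Compl, auto simp: lookup_add)
qed

lemma X_in_mono_ideal_iff: "X v \<in> mono_ideal S \<longleftrightarrow> Poly_Mapping.single v 1 \<in> S"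
  by (simp add: X_def)

lemma X_in_variables_ideal_iff [simp]: "X v \<in> variables_ideal A \<longleftrightarrow> v \<in> A"
  by (auto simp: variables_ideal_def X_in_mono_ideal_iff lookup_single when_def)

text \<open>A monomial of degree at least \<open>Suc s\<close> in the variables \<open>A\<close> is one of these variables times a
  monomial of degree at least \<open>s\<close> in them.\<close>

lemma ideal_power_variables_ideal:
  fixes A :: "'v set"
  assumes A: "finite A"
  shows "ideal_power (variables_ideal A) s =
    (mono_ideal {m. s \<le> (\<Sum>v\<in>A. Poly_Mapping.lookup m v)} :: ('v, 'k::field) mpoly set)"
proof (induction s)
  case 0
  then show ?case by (simp add: mono_ideal_def)
next
  case (Suc s)
  define S where "S s = {m :: 'v \<Rightarrow>\<^sub>0 nat. s \<le> (\<Sum>v\<in>A. Poly_Mapping.lookup m v)}" for s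
  let ?P = "variables_ideal A :: ('v, 'k) mpoly set"
  let ?prods = "{a * b | a b. a \<in> ?P \<and> b \<in> mono_ideal (S s)}"
  have "ideal_gen ?prods = mono_ideal (S (Suc s))"
  proof (rule subset_antisym)
    have "is_ideal (mono_ideal (S (Suc s)) :: ('v, 'k) mpoly set)"
      by (rule is_ideal_mono_ideal) (auto simp: S_def lookup_add sum.distrib)
    moreover have "a * b \<in> mono_ideal (S (Suc s))" if a: "a \<in> ?P" and b: "b \<in> mono_ideal (S s)" for a b
    proof (rule in_mono_idealI)
      fix m assume "m \<in> Poly_Mapping.keys (a * b)"
      then obtain m1 m2 where m: "m = m1 + m2" "m1 \<in> Poly_Mapping.keys a" "m2 \<in> Poly_Mapping.keys b"
        using keys_mult[of a b] by blast
      obtain v where "v \<in> A" "Poly_Mapping.lookup m1 v \<noteq> 0"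
        using a m(2) by (auto simp: variables_ideal_def mono_ideal_def)
      then have "1 \<le> (\<Sum>v\<in>A. Poly_Mapping.lookup m1 v)"
        using member_le_sum[of v A "Poly_Mapping.lookup m1"] A by simp
      moreover have "s \<le> (\<Sum>v\<in>A. Poly_Mapping.lookup m2 v)"
        using b m(3) by (auto simp: mono_ideal_def S_def)
      ultimately show "m \<in> S (Suc s)" by (simp add: S_def m(1) lookup_add sum.distrib)
    qed
    ultimately show "ideal_gen ?prods \<subseteq> mono_ideal (S (Suc s))"
      by (intro ideal.span_minimal) auto
    show "mono_ideal (S (Suc s)) \<subseteq> ideal_gen ?prods"
    proof (rule mono_ideal_subset_ideal)
      fix m assume m: "m \<in> S (Suc s)"
      then have "(\<Sum>v\<in>A. Poly_Mapping.lookup m v) \<noteq> 0" by (simp add: S_def)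
      then obtain v where v: "v \<in> A" "Poly_Mapping.lookup m v \<noteq> 0" 
        by (rule sum.not_neutral_contains_not_neutral)
      define m' where "m' = m - Poly_Mapping.single v 1"
      have m_eq: "m = Poly_Mapping.single v 1 + m'"
        using exponent_split_variable[OF v(2)] by (simp add: m'_def)
      have "(\<Sum>u\<in>A. Poly_Mapping.lookup m u) = 1 + (\<Sum>u\<in>A. Poly_Mapping.lookup m' u)"
        using A v(1) by (simp add: m_eq lookup_add sum.distrib lookup_single when_def)
      then have "m' \<in> S s" using m by (simp add: S_def)
      then have "Poly_Mapping.single m' (1::'k) \<in> mono_ideal (S s)" by simp
      moreover have "X v \<in> ?P" using v(1) by simp
      ultimately have "X v * Poly_Mapping.single m' 1 \<in> ideal_gen ?prods"
        by (intro ideal.span_base) blast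
      then show "Poly_Mapping.single m (1::'k) \<in> ideal_gen ?prods"
        by (simp add: X_def mult_single m_eq)
    qed simp
  qed
  then show ?case using Suc by (simp add: ideal_mult_def S_def)
qed

lemma edge_ideal_complete_graph:
  "edge_ideal (complete_graph :: 'v set set) =
    (mono_ideal {m. \<exists>u v. u \<noteq> v \<and> Poly_Mapping.lookup m u \<noteq> 0 \<and> Poly_Mapping.lookup m v \<noteq> 0} ::
       ('v, 'k::field) mpoly set)"
proof -
  let ?G = "{Poly_Mapping.single u 1 + Poly_Mapping.single v 1 | u v :: 'v. u \<noteq> v} :: ('v \<Rightarrow>\<^sub>0 nat) set"
  have "{X u * X v | u v :: 'v. {u, v} \<in> complete_graph} =
      (\<lambda>m. Poly_Mapping.single m (1::'k)) ` ?G"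
    by (auto simp: complete_graph_def doubleton_eq_iff X_def mult_single image_iff)
  moreover have "{g + n | g n. g \<in> ?G} =
      {m. \<exists>u v. u \<noteq> v \<and> Poly_Mapping.lookup m u \<noteq> 0 \<and> Poly_Mapping.lookup m v \<noteq> 0}"
  proof (intro subset_antisym subsetI)
    fix m assume "m \<in> {g + n | g n. g \<in> ?G}"
    then obtain u v n where uv: "u \<noteq> v" and "m = Poly_Mapping.single u 1 + Poly_Mapping.single v 1 + n" by blast
    then have "Poly_Mapping.lookup m u \<noteq> 0 \<and> Poly_Mapping.lookup m v \<noteq> 0" by (simp add: lookup_add)
    then show "m \<in> {m. \<exists>u v. u \<noteq> v \<and> Poly_Mapping.lookup m u \<noteq> 0 \<and> Poly_Mapping.lookup m v \<noteq> 0}"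
      using uv by blast
  next
    fix m :: "'v \<Rightarrow>\<^sub>0 nat"
    assume "m \<in> {m. \<exists>u v. u \<noteq> v \<and> Poly_Mapping.lookup m u \<noteq> 0 \<and> Poly_Mapping.lookup m v \<noteq> 0}"
    then obtain u v where uv: "u \<noteq> v" "Poly_Mapping.lookup m u \<noteq> 0" "Poly_Mapping.lookup m v \<noteq> 0" by blast
    then have "m = (Poly_Mapping.single u 1 + Poly_Mapping.single v 1) +
        (m - (Poly_Mapping.single u 1 + Poly_Mapping.single v 1))"
      by (intro poly_mapping_eqI) (auto simp: lookup_add lookup_minus lookup_single when_def)
    then show "m \<in> {g + n | g n. g \<in> ?G}" using uv(1) by blast
  qed
  ultimately show ?thesis by (simp only: edge_ideal_def ideal_gen_monomials)
qed

text \<open>The primes generated by all variables but one decompose the edge ideal. Each is associated, as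
  the annihilator of the missing variable modulo the edge ideal, and there is no other associated prime.\<close>

lemma symbolic_power_complete_graph:
  "symbolic_power (edge_ideal (complete_graph :: 'v::{finite,linorder} set set)) s =
    (mono_ideal {m. \<forall>w. s \<le> (\<Sum>v\<in>-{w}. Poly_Mapping.lookup m v)} :: ('v, 'k::field) mpoly set)"
proof -
  let ?I = "edge_ideal (complete_graph :: 'v set set) :: ('v, 'k) mpoly set"
  let ?P = "\<lambda>w. variables_ideal (- {w}) :: ('v, 'k) mpoly set"
  have Inter: "(\<Inter>w. ?P w) = ?I"
  proof -
    have "(\<forall>w. \<exists>v\<in>-{w}. Poly_Mapping.lookup m v \<noteq> 0) \<longleftrightarrow>
        (\<exists>u v. u \<noteq> v \<and> Poly_Mapping.lookup m u \<noteq> 0 \<and> Poly_Mapping.lookup m v \<noteq> 0)"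
      for m :: "'v \<Rightarrow>\<^sub>0 nat"
      by (metis ComplI Compl_iff insert_iff singletonD)
    then show ?thesis
      unfolding variables_ideal_def mono_ideal_Inter edge_ideal_complete_graph
      by (intro arg_cong[where f = mono_ideal]) auto
  qed
  have decomp: "primary_decomposition (range ?P) ?I"
    using Inter prime_imp_primary[OF prime_ideal_variables_ideal] by (auto simp: primary_decomposition_def)
  have le_iff: "?P v \<subseteq> ?P w \<longleftrightarrow> v = w" for v w
  proof
    assume "?P v \<subseteq> ?P w"
    moreover have "X w \<notin> ?P w" by simp
    ultimately have "X w \<notin> ?P v" by blast
    then show "v = w" by simp
  qed simp
  have "?P w \<in> associated_primes ?I" for w
  proof -
    have "g * X w \<in> ?I \<longleftrightarrow> g \<in> ?P w" for g
    proof -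
      have "g * X w \<in> ?I \<longleftrightarrow> (\<forall>v. g * X w \<in> ?P v)" by (simp flip: Inter)
      also have "\<dots> \<longleftrightarrow> g * X w \<in> ?P w"
      proof -
        have "g * X w \<in> ?P v" if "v \<noteq> w" for v
          using ideal.subspace_scale[of "?P v" "X w" g] prime_ideal_variables_ideal[of "- {v}"] that
          by (auto simp: prime_ideal_def)
        then show ?thesis by metis
      qed
      also have "\<dots> \<longleftrightarrow> g \<in> ?P w"
        by (rule prime_ideal_colon[OF prime_ideal_variables_ideal]) simp
      finally show ?thesis .
    qed
    then show ?thesis
      using prime_ideal_variables_ideal by (auto simp: associated_primes_def intro!: exI[of _ "X w"])
  qed
  moreover have "associated_primes ?I \<subseteq> range ?P"
    using associated_prime_of_Inter[of "range ?P"] prime_ideal_variables_ideal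
    by (auto simp: Inter)
  ultimately have "associated_primes ?I = range ?P" by blast
  then have max: "maximal_associated_primes ?I = range ?P"
    by (auto simp: maximal_associated_primes_def le_iff)
  have below: "components_below (range ?P) (?P w) = ?P w" for w
  proof -
    have "{P \<in> range ?P. radical P \<subseteq> ?P w} = {?P w}"
      by (auto simp: prime_imp_radical_eq[OF prime_ideal_variables_ideal] le_iff)
    then show ?thesis by (simp add: components_below_def)
  qed
  have "symbolic_power ?I s = (\<Inter>w. ideal_power (?P w) s)"
    by (simp add: symbolic_power_eq[OF decomp] max below)
  also have "\<dots> = mono_ideal {m. \<forall>w. s \<le> (\<Sum>v\<in>-{w}. Poly_Mapping.lookup m v)}"
    by (subst ideal_power_variables_ideal) (auto simp: mono_ideal_def)
  finally show ?thesis .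
qed

section \<open>Syzygies of triangular shape\<close>

lemma sum_times_indicator:
  fixes g :: "'b \<Rightarrow> 'a::comm_ring_1"
  assumes "finite B" "a \<in> B"
  shows "(\<Sum>p\<in>B. g p * (if p = a then x else 0)) = g a * x"
proof -
  have "(\<Sum>p\<in>B. g p * (if p = a then x else 0)) = (\<Sum>p\<in>B. if p = a then g p * x else 0)"
    by (intro sum.cong) auto
  then show ?thesis using assms by simp
qed

lemma ideal_gen_image_eq_combinations:
  assumes B: "finite B" and f: "f \<in> ideal_gen (g ` B)"
  shows "\<exists>v\<in>free_module B. f = (\<Sum>q\<in>B. g q * v q)"
  using f
proof (induction rule: ideal.span_induct_alt)
  case base
  then show ?case by (intro bexI[of _ "\<lambda>_. 0"]) (auto simp: free_module_def)
next
  case (step c x y)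
  then obtain v p where v: "v \<in> free_module B" "y = (\<Sum>q\<in>B. g q * v q)" and p: "p \<in> B" "x = g p"
    by blast
  have "(\<Sum>q\<in>B. g q * (v q + (if q = p then c else 0))) = y + g p * c"
    using B p(1) by (simp only: distrib_left sum.distrib v(2) sum_times_indicator)
  then show ?case
    using v(1) p
    by (intro bexI[of _ "\<lambda>q. v q + (if q = p then c else 0)"])
      (auto simp: free_module_def add.commute mult.commute)
qed

text \<open>This describes the first differential of a resolution.\<close>

lemma image_row_matrix:
  assumes B: "finite B"
  shows "mat_map {r} B (\<lambda>_. g) ` free_module B = {v \<in> free_module {r}. v r \<in> ideal_gen (g ` B)}"
proof (intro subset_antisym subsetI)
  fix v assume "v \<in> mat_map {r} B (\<lambda>_. g) ` free_module B"
  then obtain y where v: "v = mat_map {r} B (\<lambda>_. g) y" by blast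
  have "(\<Sum>q\<in>B. y q * g q) \<in> ideal_gen (g ` B)"
    by (intro ideal.span_sum ideal.span_scale ideal.span_base) simp
  then show "v \<in> {v \<in> free_module {r}. v r \<in> ideal_gen (g ` B)}"
    by (simp add: v mult.commute) (simp add: mat_map_def)
next
  fix v assume v: "v \<in> {v \<in> free_module {r}. v r \<in> ideal_gen (g ` B)}"
  then obtain y where y: "y \<in> free_module B" "v r = (\<Sum>q\<in>B. g q * y q)"
    using ideal_gen_image_eq_combinations[OF B] by blast
  have "v = mat_map {r} B (\<lambda>_. g) y"
    using v y(2) by (auto simp: mat_map_def free_module_def)
  then show "v \<in> mat_map {r} B (\<lambda>_. g) ` free_module B" using y(1) by blast
qed

text \<open>Generators \<open>g p\<close>, ordered by \<open>rank\<close>, such that for each \<open>p\<close> but the first the colon ideal of the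
  preceding generators by \<open>g p\<close> is principal, generated by a non-zero-divisor. The syzygy \<open>q\<close> comes
  from the generator \<open>head q\<close>; its colon ideal is generated by \<open>u q\<close>, and \<open>u q * g (head q)\<close> is a
  multiple of the single earlier generator \<open>g (par q)\<close>. The generators and the parent relation form
  a tree with root the first generator.\<close>

locale triangular_syzygies =
  fixes B :: "'b set" and C :: "'c set" and g :: "'b \<Rightarrow> 'a::comm_ring_1" and rank :: "'b \<Rightarrow> nat"
    and root :: 'b and head par :: "'c \<Rightarrow> 'b" and u w :: "'c \<Rightarrow> 'a"
  assumes finite_B: "finite B" and root: "root \<in> B" and inj_rank: "inj_on rank B"
    and rank_root: "\<And>p. p \<in> B \<Longrightarrow> p \<noteq> root \<Longrightarrow> rank root < rank p"
    and head: "bij_betw head C (B - {root})"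
    and par: "\<And>q. q \<in> C \<Longrightarrow> par q \<in> B" "\<And>q. q \<in> C \<Longrightarrow> rank (par q) < rank (head q)"
    and rel: "\<And>q. q \<in> C \<Longrightarrow> u q * g (head q) = w q * g (par q)"
    and root_regular: "\<And>x. x * g root = 0 \<Longrightarrow> x = 0"
    and u_regular: "\<And>q x. q \<in> C \<Longrightarrow> x * u q = 0 \<Longrightarrow> x = 0"
    and colon: "\<And>q v. q \<in> C \<Longrightarrow> v * g (head q) \<in> ideal_gen (g ` {p \<in> B. rank p < rank (head q)}) \<Longrightarrow>
      \<exists>x. v = x * u q"
begin

definition syz :: "'b \<Rightarrow> 'c \<Rightarrow> 'a"
  where "syz p q = (if p = head q then u q else 0) - (if p = par q then w q else 0)"

lemma finite_C: "finite C"
  using bij_betw_finite[OF head] finite_B by simp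

lemma head_in: "q \<in> C \<Longrightarrow> head q \<in> B"
  using head by (auto simp: bij_betw_def)

lemma head_inj: "q \<in> C \<Longrightarrow> q' \<in> C \<Longrightarrow> head q = head q' \<Longrightarrow> q = q'"
  using head by (auto simp: bij_betw_def inj_on_def)

lemma par_neq_head: "q \<in> C \<Longrightarrow> par q \<noteq> head q"
  using par(2) by force

lemma syz_is_syzygy:
  assumes "q \<in> C"
  shows "(\<Sum>p\<in>B. g p * syz p q) = 0"
  using rel[OF assms] finite_B head_in[OF assms] par(1)[OF assms]
  by (simp add: syz_def right_diff_distrib sum_subtractf sum_times_indicator mult.commute)

lemma image_is_syzygy: "(\<Sum>p\<in>B. g p * mat_map B C syz y p) = 0"
proof -
  have "(\<Sum>p\<in>B. g p * mat_map B C syz y p) = (\<Sum>p\<in>B. \<Sum>q\<in>C. (g p * syz p q) * y q)"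
    by (simp add: mat_map_def sum_distrib_left)
  also have "\<dots> = (\<Sum>q\<in>C. (\<Sum>p\<in>B. g p * syz p q) * y q)"
    by (subst sum.swap) (simp add: sum_distrib_right)
  finally show ?thesis by (simp add: syz_is_syzygy)
qed

text \<open>Induction on a bound for the ranks in the support of the syzygy \<open>v\<close>. Its coefficient at the
  highest generator lies in the colon ideal there, so subtracting a multiple of the syzygy with that
  head kills this coefficient and creates only lower ones.\<close>

lemma syzygy_in_image:
  assumes "v \<in> free_module B" "(\<Sum>p\<in>B. g p * v p) = 0" "\<And>p. p \<in> B \<Longrightarrow> n \<le> rank p \<Longrightarrow> v p = 0"
  shows "\<exists>y\<in>free_module C. mat_map B C syz y = v"
  using assms
proof (induction n arbitrary: v)
  case 0
  then have "v = (\<lambda>_. 0)" by (auto simp: free_module_def fun_eq_iff)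
  then show ?case by (intro bexI[of _ "\<lambda>_. 0"]) (auto simp: free_module_def)
next
  case (Suc n)
  show ?case
  proof (cases "\<exists>p\<in>B. rank p = n \<and> v p \<noteq> 0")
    case False
    have "v p = 0" if "p \<in> B" "n \<le> rank p" for p
      using False Suc.prems(3)[of p] that by (cases "rank p = n") auto
    then show ?thesis using Suc.IH Suc.prems(1,2) by blast
  next
    case True
    then obtain p where p: "p \<in> B" "rank p = n" "v p \<noteq> 0" by blast
    have split: "v p * g p + (\<Sum>r\<in>B - {p}. g r * v r) = 0"
      using Suc.prems(2) sum.remove[OF finite_B p(1), of "\<lambda>r. g r * v r"] by (simp add: mult.commute)
    have above: "v r = 0" if "r \<in> B - {p}" "\<not> rank r < n" for r
    proof -
      have "rank r \<noteq> n" using that inj_onD[OF inj_rank, of r p] p by auto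
      then show ?thesis using that Suc.prems(3)[of r] by auto
    qed
    have "p \<noteq> root"
    proof
      assume "p = root"
      then have "v r = 0" if "r \<in> B - {p}" for r
        using above[OF that] rank_root[of r] that p(2) by auto
      then show False using split root_regular[of "v p"] p(3) \<open>p = root\<close> by simp
    qed
    then have "p \<in> head ` C" using head p(1) by (simp add: bij_betw_def)
    then obtain q where q: "q \<in> C" "head q = p" by blast
    have "(\<Sum>r\<in>B - {p}. - v r * g r) \<in> ideal_gen (g ` {r \<in> B. rank r < rank p})"
    proof (intro ideal.span_sum)
      fix r assume r: "r \<in> B - {p}"
      show "- v r * g r \<in> ideal_gen (g ` {r \<in> B. rank r < rank p})"
      proof (cases "rank r < n")
        case True
        then show ?thesis by (intro ideal.span_scale ideal.span_base) (use r p(2) in auto)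
      next
        case False
        then show ?thesis using above[OF r] by (simp add: ideal.span_zero)
      qed
    qed
    moreover have "v p * g p = (\<Sum>r\<in>B - {p}. - v r * g r)"
      using split by (simp add: sum_negf eq_neg_iff_add_eq_0 mult.commute)
    ultimately obtain x where x: "v p = x * u q" using colon[OF q(1), of "v p"] q(2) by auto
    define e where "e = (\<lambda>r. if r = q then x else 0)"
    have col: "mat_map B C syz e = (\<lambda>r. if r \<in> B then syz r q * x else 0)"
      using q(1) finite_C by (simp add: mat_map_def e_def if_distrib cong: if_cong)
    define v' where "v' = (\<lambda>r. v r - mat_map B C syz e r)"
    have "v' \<in> free_module B"
      using Suc.prems(1) by (simp add: v'_def free_module_def mat_map_def)
    moreover have "(\<Sum>r\<in>B. g r * v' r) = 0"
      using Suc.prems(2) image_is_syzygy[of e]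
      by (simp add: v'_def right_diff_distrib sum_subtractf)
    moreover have "v' r = 0" if r: "r \<in> B" "n \<le> rank r" for r
    proof (cases "r = p")
      case True
      then show ?thesis
        using par_neq_head[OF q(1)] q(2) p(1) x by (simp add: v'_def col syz_def mult.commute)
    next
      case False
      have "r \<noteq> par q" using par(2)[OF q(1)] q(2) p(2) r(2) by auto
      then show ?thesis using False r q(2) above[of r] by (simp add: v'_def col syz_def)
    qed
    ultimately obtain y where y: "y \<in> free_module C" "mat_map B C syz y = v'" using Suc.IH by blast
    have "mat_map B C syz (\<lambda>r. y r + e r) = v"
      by (simp add: mat_map_add y(2) v'_def)
    moreover have "(\<lambda>r. y r + e r) \<in> free_module C"
      using y(1) q(1) by (auto simp: free_module_def e_def)
    ultimately show ?thesis by blast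
  qed
qed

lemma image_eq_syzygies:
  "mat_map B C syz ` free_module C = {v \<in> free_module B. (\<Sum>p\<in>B. g p * v p) = 0}"
proof (intro subset_antisym subsetI)
  fix v assume v: "v \<in> {v \<in> free_module B. (\<Sum>p\<in>B. g p * v p) = 0}"
  have "v p = 0" if "p \<in> B" "Suc (Max (rank ` B)) \<le> rank p" for p
  proof -
    have "rank p \<le> Max (rank ` B)" by (rule Max_ge) (use finite_B that in auto)
    then show ?thesis using that(2) by simp
  qed
  then have "\<exists>y\<in>free_module C. mat_map B C syz y = v" using syzygy_in_image v by blast
  then show "v \<in> mat_map B C syz ` free_module C" by blast
qed (auto simp: image_is_syzygy)

text \<open>Among the columns in the support of \<open>y\<close> take the one whose head has the highest rank. No other
  column of the support meets the row of that head, so this row reads \<open>y q * u q = 0\<close>.\<close>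

lemma syz_injective:
  assumes y: "y \<in> free_module C" and zero: "mat_map B C syz y = (\<lambda>_. 0)"
  shows "y = (\<lambda>_. 0)"
proof (rule ccontr)
  assume "y \<noteq> (\<lambda>_. 0)"
  define A where "A = {q \<in> C. y q \<noteq> 0}"
  have A: "finite A" "A \<noteq> {}"
    using \<open>y \<noteq> (\<lambda>_. 0)\<close> y finite_C by (auto simp: A_def free_module_def fun_eq_iff)
  let ?f = "\<lambda>q. rank (head q)"
  have "Max (?f ` A) \<in> ?f ` A" using A by (intro Max_in) auto
  then obtain q where q: "q \<in> A" "?f q = Max (?f ` A)" by auto
  have top: "?f r \<le> ?f q" if "r \<in> A" for r using that A(1) q(2) by simp
  have qC: "q \<in> C" "y q \<noteq> 0" using q(1) by (auto simp: A_def)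
  have "syz (head q) r * y r = 0" if r: "r \<in> C - {q}" for r
  proof (cases "y r = 0")
    case False
    then have "?f r \<le> ?f q" using r top by (simp add: A_def)
    then have "head q \<noteq> par r" using par(2)[of r] r by auto
    moreover have "head q \<noteq> head r" using head_inj[OF qC(1), of r] r by auto
    ultimately show ?thesis by (simp add: syz_def)
  qed simp
  then have "mat_map B C syz y (head q) = syz (head q) q * y q"
    using sum.remove[OF finite_C qC(1), of "\<lambda>r. syz (head q) r * y r"] head_in[OF qC(1)]
    by (simp add: mat_map_def)
  also have "\<dots> = y q * u q" using par_neq_head[OF qC(1)] by (simp add: syz_def mult.commute)
  finally show False using zero u_regular[OF qC(1), of "y q"] qC(2) by simp
qed

end

section \<open>Generators and syzygies for the triangle graph\<close>

lemma type3_cases: "v = of_nat 0 \<or> v = of_nat 1 \<or> v = of_nat (2::nat)" for v :: 3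
proof (induct v)
  case (of_int z)
  then have "z = 0 \<or> z = 1 \<or> z = 2" by auto
  then show ?case by auto
qed

lemma of_nat_type3_eq_iff:
  assumes "c < 3" "d < 3"
  shows "(of_nat c :: 3) = of_nat d \<longleftrightarrow> c = d"
proof -
  have "c \<in> {0, 1, 2}" "d \<in> {0, 1, 2}" using assms by auto
  then show ?thesis by auto
qed

lemma obtain_type3_index:
  obtains c where "c < 3" "v = (of_nat c :: 3)"
proof -
  have "v \<in> of_nat ` {0, 1, 2 :: nat}" using type3_cases[of v] by blast
  then obtain c :: nat where "c \<in> {0, 1, 2}" "v = of_nat c" by blast
  then show ?thesis by (intro that[of c]) auto
qed

text \<open>The generator with index \<open>(j, c)\<close> is the one of degree \<open>j\<close> on the arm of the variable \<open>c\<close>. In terms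
  of \<open>t = 2 * s - j\<close>, its exponent is \<open>t\<close> at that variable and \<open>s - t = j - s\<close> at the two others.\<close>

definition gen_exp :: "nat \<Rightarrow> nat \<times> nat \<Rightarrow> (3 \<Rightarrow>\<^sub>0 nat)"
  where "gen_exp s p = Abs_poly_mapping (\<lambda>v. if v = of_nat (snd p) then 2 * s - fst p else fst p - s)"

lemma lookup_gen_exp:
  "Poly_Mapping.lookup (gen_exp s p) v = (if v = of_nat (snd p) then 2 * s - fst p else fst p - s)"
  by (simp add: gen_exp_def)

definition gen_count :: "nat \<Rightarrow> nat \<Rightarrow> nat"
  where "gen_count s j = (if 2 * j = 3 * s then 1 else if 3 * s < 2 * j \<and> j \<le> 2 * s then 3 else 0)"

text \<open>The smallest degree of a generator, which is \<open>3 s / 2\<close> rounded up.\<close>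

definition root_degree :: "nat \<Rightarrow> nat"
  where "root_degree s = (3 * s + 1) div 2"

text \<open>The root of the tree of generators is the last generator of smallest degree. Taking the last one
  allows a syzygy to keep the second index of its head, since the syzygies of a given degree then
  have second indices without gaps.\<close>

definition root_index :: "nat \<Rightarrow> nat \<times> nat"
  where "root_index s = (root_degree s, gen_count s (root_degree s) - 1)"

definition betti_table :: "nat \<Rightarrow> nat \<Rightarrow> nat \<Rightarrow> nat"
  where "betti_table s i j =
    (if i = 0 then if j = 0 then 1 else 0
     else if i = 1 then gen_count s j
     else if i = 2 \<and> j \<noteq> 0 then gen_count s (j - 1) - (if j - 1 = root_degree s then 1 else 0)
     else 0)"

definition syz_head :: "nat \<times> nat \<Rightarrow> nat \<times> nat"
  where "syz_head q = (fst q - 1, snd q)"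

text \<open>The parent of a generator is its inner neighbour on the same arm. At the inner end of the arms, the
  parent is the root: for even \<open>s\<close> the arms meet in the root, and for odd \<open>s\<close> the three innermost
  generators have the same degree and one of them is the root.\<close>

definition syz_parent :: "nat \<Rightarrow> nat \<times> nat \<Rightarrow> nat \<times> nat"
  where "syz_parent s q =
    (if fst q - 1 = root_degree s \<or> (fst q - 1 = Suc (root_degree s) \<and> even s) then root_index s
     else (fst q - 2, snd q))"

text \<open>Generators are ordered by degree, and in the same degree by decreasing second index; thus the root
  comes first.\<close>

definition gen_rank :: "nat \<times> nat \<Rightarrow> nat"
  where "gen_rank p = 3 * fst p + (2 - snd p)"

text \<open>The least common multiple of head and parent is \<open>x\<^sub>c\<close> times the head; this is its quotient by the
  parent.\<close>

definition cofactor :: "nat \<Rightarrow> nat \<times> nat \<Rightarrow> (3 \<Rightarrow>\<^sub>0 nat)"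
  where "cofactor s q =
    gen_exp s (syz_head q) + Poly_Mapping.single (of_nat (snd q)) 1 - gen_exp s (syz_parent s q)"

abbreviation gens :: "nat \<Rightarrow> (nat \<times> nat) set"
  where "gens s \<equiv> res_basis (betti_table s) (Suc 0)"

abbreviation syzs :: "nat \<Rightarrow> (nat \<times> nat) set"
  where "syzs s \<equiv> res_basis (betti_table s) (Suc (Suc 0))"

lemma in_gens_iff: "p \<in> gens s \<longleftrightarrow> 3 * s \<le> 2 * fst p \<and> fst p \<le> 2 * s \<and> snd p < 3 \<and> (2 * fst p = 3 * s \<longrightarrow> snd p = 0)"
  by (cases p) (auto simp: res_basis_def betti_table_def gen_count_def)

lemma root_index_eq: "root_index s = (root_degree s, if even s then 0 else 2)" if "s \<ge> 1"
  using that by (auto simp: root_index_def gen_count_def root_degree_def elim!: evenE oddE)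

lemma root_degree_le: "p \<in> gens s \<Longrightarrow> root_degree s \<le> fst p"
  by (auto simp: in_gens_iff root_degree_def)

lemma root_in_gens: "root_index s \<in> gens s" if "s \<ge> 1"
  using that unfolding root_index_eq[OF that] in_gens_iff root_degree_def
  by (auto elim!: evenE oddE)

lemma in_syzs_iff:
  assumes s: "s \<ge> 1"
  shows "q \<in> syzs s \<longleftrightarrow> fst q \<noteq> 0 \<and> syz_head q \<in> gens s - {root_index s}"
proof (cases q)
  case (Pair j c)
  have "gen_count s (root_degree s) \<ge> 1"
    using s by (auto simp: gen_count_def root_degree_def)
  then show ?thesis
    by (auto simp: Pair res_basis_def betti_table_def syz_head_def root_index_def)
qed

lemma bij_syz_head:
  assumes "s \<ge> 1"
  shows "bij_betw syz_head (syzs s) (gens s - {root_index s})"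
proof (rule bij_betw_byWitness[where f' = "\<lambda>p. (Suc (fst p), snd p)"])
  show "\<forall>q\<in>syzs s. (Suc (fst (syz_head q)), snd (syz_head q)) = q"
    using in_syzs_iff[OF assms] by (auto simp: syz_head_def)
  show "syz_head ` syzs s \<subseteq> gens s - {root_index s}"
    using in_syzs_iff[OF assms] by auto
  show "(\<lambda>p. (Suc (fst p), snd p)) ` (gens s - {root_index s}) \<subseteq> syzs s"
    using in_syzs_iff[OF assms] by (auto simp: syz_head_def)
qed (simp add: syz_head_def)

lemma syz_cases:
  assumes s: "s \<ge> 1" and q: "q \<in> syzs s"
  obtains (odd_root) c where "q = (Suc (root_degree s), c)" "odd s" "c < 2" "syz_parent s q = (root_degree s, 2)"
    | (even_root) c where "q = (Suc (Suc (root_degree s)), c)" "even s" "c < 3" "syz_parent s q = (root_degree s, 0)"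
        "root_degree s < 2 * s"
    | (arm) j c where "q = (Suc (Suc j), c)" "3 * s < 2 * j" "j < 2 * s" "c < 3" "syz_parent s q = (j, c)"
proof -
  obtain j c where qe: "q = (Suc j, c)" using in_syzs_iff[OF s, of q] q by (cases q; cases "fst q") auto
  then have p: "(j, c) \<in> gens s" "(j, c) \<noteq> root_index s"
    using in_syzs_iff[OF s, of q] q by (auto simp: syz_head_def)
  note p' = p[unfolded in_gens_iff root_index_eq[OF s]]
  consider "j = root_degree s" | "j = Suc (root_degree s)" "even s"
    | "j \<noteq> root_degree s" "\<not> (j = Suc (root_degree s) \<and> even s)" by blast
  then show ?thesis
  proof cases
    case 1
    have "odd s"
      using p' 1 by (auto simp: root_degree_def elim!: evenE)
    moreover have "c < 2" using p' 1 \<open>odd s\<close> by auto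
    ultimately show ?thesis
      using odd_root qe 1 by (simp add: syz_parent_def root_index_eq[OF s])
  next
    case 2
    then show ?thesis
      using even_root qe p' by (simp add: syz_parent_def root_index_eq[OF s])
  next
    case 3
    have "root_degree s \<le> j" using root_degree_le[OF p(1)] by simp
    then obtain i where j: "j = Suc i" "root_degree s \<le> i" using 3(1) by (cases j) auto
    have "3 * s < 2 * i"
    proof (cases "i = root_degree s")
      case True
      then have "odd s" using 3(2) j(1) by simp
      then show ?thesis unfolding True root_degree_def by presburger
    next
      case False
      then show ?thesis using j(2) unfolding root_degree_def by linarith
    qed
    moreover have "syz_parent s q = (i, c)"
      using 3 j(1) by (auto simp: syz_parent_def qe)
    ultimately show ?thesis using arm qe p' j(1) by auto
  qed
qed

lemma syz_parent_properties:
  assumes s: "s \<ge> 1" and q: "q \<in> syzs s"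
  shows "syz_parent s q \<in> gens s" "gen_rank (syz_parent s q) < gen_rank (syz_head q)"
    "fst (syz_parent s q) \<le> fst (syz_head q)"
    "gen_exp s (syz_head q) + Poly_Mapping.single (of_nat (snd q)) 1 = cofactor s q + gen_exp s (syz_parent s q)"
proof -
  have "syz_parent s q \<in> gens s \<and> gen_rank (syz_parent s q) < gen_rank (syz_head q) \<and>
    fst (syz_parent s q) \<le> fst (syz_head q) \<and>
    (\<forall>v. Poly_Mapping.lookup (gen_exp s (syz_parent s q)) v \<le>
       Poly_Mapping.lookup (gen_exp s (syz_head q) + Poly_Mapping.single (of_nat (snd q)) 1) v)"
    using s q
  proof (cases rule: syz_cases)
    case (odd_root c)
    have "\<exists>t. s = 2 * t + 1" using odd_root(2) by (auto elim!: oddE)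
    then obtain t where t: "s = 2 * t + 1" ..
    have deg: "root_degree s = 3 * t + 2" by (simp add: root_degree_def t)
    have "(of_nat c :: 3) \<noteq> of_nat 2" using of_nat_type3_eq_iff[of c 2] odd_root(3) by simp
    then show ?thesis
      using odd_root(3) unfolding odd_root(4) unfolding odd_root(1) deg
      by (auto simp: in_gens_iff gen_rank_def syz_head_def lookup_add lookup_gen_exp lookup_single when_def t)
  next
    case (even_root c)
    have "\<exists>t. s = 2 * t" using even_root(2) by (auto elim!: evenE)
    then obtain t where t: "s = 2 * t" ..
    have deg: "root_degree s = 3 * t" by (simp add: root_degree_def t)
    show ?thesis
      using even_root(3,5) unfolding even_root(4) unfolding even_root(1) deg
      by (auto simp: in_gens_iff gen_rank_def syz_head_def lookup_add lookup_gen_exp lookup_single when_def t)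
  next
    case (arm j c)
    show ?thesis
      using arm(2,3,4) unfolding arm(5) unfolding arm(1)
      by (auto simp: in_gens_iff gen_rank_def syz_head_def lookup_add lookup_gen_exp lookup_single when_def)
  qed
  then show "syz_parent s q \<in> gens s" "gen_rank (syz_parent s q) < gen_rank (syz_head q)"
    "fst (syz_parent s q) \<le> fst (syz_head q)"
    "gen_exp s (syz_head q) + Poly_Mapping.single (of_nat (snd q)) 1 = cofactor s q + gen_exp s (syz_parent s q)"
    by (auto intro!: poly_mapping_eqI simp: cofactor_def lookup_add lookup_minus)
qed

lemma rank_injective: "inj_on gen_rank (gens s)"
proof (rule inj_onI)
  fix p q assume "p \<in> gens s" "q \<in> gens s" "gen_rank p = gen_rank q"
  then have "snd p < 3" "snd q < 3" "3 * fst p + (2 - snd p) = 3 * fst q + (2 - snd q)"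
    by (auto simp: in_gens_iff gen_rank_def)
  then have "fst p = fst q \<and> snd p = snd q" by presburger
  then show "p = q" by (simp add: prod_eq_iff)
qed

lemma rank_root:
  assumes "s \<ge> 1" "p \<in> gens s" "p \<noteq> root_index s"
  shows "gen_rank (root_index s) < gen_rank p"
proof (cases "fst p = root_degree s")
  case True
  then show ?thesis
    using assms by (cases p) (auto simp: root_index_eq in_gens_iff gen_rank_def root_degree_def elim!: evenE oddE)
next
  case False
  then have "root_degree s < fst p" using root_degree_le[OF assms(2)] by simp
  then show ?thesis using assms by (auto simp: gen_rank_def root_index_eq in_gens_iff)
qed

text \<open>This is the colon condition in terms of exponents: no earlier generator divides the product of
  \<open>x\<^sup>m\<close> and the given generator unless the variable of its arm occurs in \<open>m\<close>. An earlier generator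
  on the same arm has a smaller degree, hence a larger exponent \<open>2 * s - j\<close>. On another arm the
  exponent to compare is \<open>j' - s\<close>, and \<open>j + j' > 3 * s\<close> because at most one generator has degree
  \<open>3 s / 2\<close>.\<close>

lemma lower_gen_needs_variable:
  assumes p: "p \<in> gens s" and q: "q \<in> gens s" and less: "gen_rank q < gen_rank p"
  shows "Poly_Mapping.lookup (gen_exp s p) (of_nat (snd p)) < Poly_Mapping.lookup (gen_exp s q) (of_nat (snd p))"
proof -
  have le: "fst q \<le> fst p" using p q less by (auto simp: gen_rank_def in_gens_iff)
  show ?thesis
  proof (cases "snd p = snd q")
    case True
    then have "fst q < fst p" using less le by (auto simp: gen_rank_def)
    then show ?thesis using True p by (auto simp: lookup_gen_exp in_gens_iff)
  next
    case False
    then have "(of_nat (snd p) :: 3) \<noteq> of_nat (snd q)"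
      using of_nat_type3_eq_iff[of "snd p" "snd q"] p q by (simp add: in_gens_iff)
    moreover have "3 * s < fst p + fst q"
      using p q False le by (auto simp: in_gens_iff)
    ultimately show ?thesis using p q by (auto simp: lookup_gen_exp in_gens_iff)
  qed
qed

lemma mono_degree_gen_exp:
  assumes "p \<in> gens s"
  shows "mono_degree (gen_exp s p) = fst p"
proof -
  let ?c = "of_nat (snd p) :: 3"
  have "mono_degree (gen_exp s p) = Poly_Mapping.lookup (gen_exp s p) ?c +
      (\<Sum>v\<in>UNIV - {?c}. Poly_Mapping.lookup (gen_exp s p) v)"
    unfolding mono_degree_def by (rule sum.remove) simp_all
  also have "(\<Sum>v\<in>UNIV - {?c}. Poly_Mapping.lookup (gen_exp s p) v) = (\<Sum>v\<in>UNIV - {?c}. fst p - s)"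
    by (intro sum.cong) (auto simp: lookup_gen_exp)
  also have "\<dots> = 2 * (fst p - s)" by (simp add: card_Diff_singleton)
  finally show ?thesis using assms by (auto simp: lookup_gen_exp in_gens_iff)
qed

lemma two_coordinate_sums:
  fixes m :: "3 \<Rightarrow>\<^sub>0 nat"
  shows "(\<forall>w. s \<le> (\<Sum>v\<in>-{w}. Poly_Mapping.lookup m v)) \<longleftrightarrow>
    (\<forall>u v. u \<noteq> v \<longrightarrow> s \<le> Poly_Mapping.lookup m u + Poly_Mapping.lookup m v)"
proof (intro iffI allI impI)
  fix u v :: 3
  assume *: "\<forall>w. s \<le> (\<Sum>v\<in>-{w}. Poly_Mapping.lookup m v)" and uv: "u \<noteq> v"
  have "card (- {u, v}) = 1" using uv by (simp add: Compl_eq_Diff_UNIV card_Diff_subset)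
  then obtain w where "- {u, v} = {w}" by (auto simp: card_1_singleton_iff)
  then have "- {w} = {u, v}" by blast
  then show "s \<le> Poly_Mapping.lookup m u + Poly_Mapping.lookup m v"
    using *[rule_format, of w] uv by simp
next
  fix w :: 3
  assume *: "\<forall>u v. u \<noteq> v \<longrightarrow> s \<le> Poly_Mapping.lookup m u + Poly_Mapping.lookup m v"
  have "card (- {w}) = 2" by (simp add: Compl_eq_Diff_UNIV card_Diff_subset)
  then obtain u v where "- {w} = {u, v}" "u \<noteq> v" by (auto simp: card_2_iff)
  then show "s \<le> (\<Sum>v\<in>-{w}. Poly_Mapping.lookup m v)" using * by simp
qed

text \<open>Below an exponent \<open>m\<close> with large pairwise sums there is a generator on the arm of the variable where
  \<open>m\<close> is smallest: its parameter \<open>t\<close> is that smallest exponent, but at most \<open>s / 2\<close>.\<close>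

lemma gens_generate:
  assumes s: "s \<ge> 1"
  shows "{g + n | g n. g \<in> gen_exp s ` gens s} = {m. \<forall>w. s \<le> (\<Sum>v\<in>-{w}. Poly_Mapping.lookup m v)}"
proof (intro subset_antisym subsetI)
  fix m assume "m \<in> {g + n | g n. g \<in> gen_exp s ` gens s}"
  then obtain p n where m: "m = gen_exp s p + n" and p: "p \<in> gens s" by blast
  then show "m \<in> {m. \<forall>w. s \<le> (\<Sum>v\<in>-{w}. Poly_Mapping.lookup m v)}"
    unfolding two_coordinate_sums mem_Collect_eq
    by (auto simp: lookup_add lookup_gen_exp in_gens_iff)
next
  fix m :: "3 \<Rightarrow>\<^sub>0 nat"
  assume "m \<in> {m. \<forall>w. s \<le> (\<Sum>v\<in>-{w}. Poly_Mapping.lookup m v)}"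
  then have pair: "s \<le> Poly_Mapping.lookup m u + Poly_Mapping.lookup m v" if "u \<noteq> v" for u v
    using that by (simp add: two_coordinate_sums)
  have "Min (range (Poly_Mapping.lookup m)) \<in> range (Poly_Mapping.lookup m)" by (rule Min_in) auto
  then obtain w where "Min (range (Poly_Mapping.lookup m)) = Poly_Mapping.lookup m w" by (rule imageE)
  then have w: "Poly_Mapping.lookup m w \<le> Poly_Mapping.lookup m v" for v
    using Min_le[of "range (Poly_Mapping.lookup m)" "Poly_Mapping.lookup m v"] by simp
  obtain c where c: "c < 3" "w = of_nat c" by (rule obtain_type3_index)
  define t where "t = min (Poly_Mapping.lookup m w) (s div 2)"
  \<comment> \<open>For \<open>t = s / 2\<close> the arms meet, and \<open>0\<close> is the only second index in that degree.\<close>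
  define p where "p = (2 * s - t, if 2 * t = s then 0 else c)"
  have t: "t \<le> s div 2" "t \<le> Poly_Mapping.lookup m w" by (simp_all add: t_def)
  have p: "p \<in> gens s" using t(1) c(1) by (auto simp: p_def in_gens_iff)
  have "Poly_Mapping.lookup (gen_exp s p) v \<le> Poly_Mapping.lookup m v" for v
  proof (cases "2 * t = s")
    case True
    then show ?thesis using w[of v] t(2) by (auto simp: lookup_gen_exp p_def)
  next
    case False
    have "s - t \<le> Poly_Mapping.lookup m v" if "v \<noteq> w"
      using pair[OF that] w[of v] False unfolding t_def by (auto simp: min_def split: if_splits)
    then show ?thesis using False t w[of v] c(2) by (auto simp: lookup_gen_exp p_def)
  qed
  then have "m = gen_exp s p + (m - gen_exp s p)"
    by (intro poly_mapping_eqI) (simp add: lookup_add lookup_minus)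
  then show "m \<in> {g + n | g n. g \<in> gen_exp s ` gens s}" using p by blast
qed

section \<open>The minimal resolution\<close>

lemma triangular_syzygies_gens:
  assumes s: "s \<ge> 1"
  shows "triangular_syzygies (gens s) (syzs s) (\<lambda>p. Poly_Mapping.single (gen_exp s p) (1::'k::field))
    gen_rank (root_index s) syz_head (syz_parent s) (\<lambda>q. X (of_nat (snd q)))
    (\<lambda>q. Poly_Mapping.single (cofactor s q) 1)"
proof
  show "finite (gens s)"
    by (rule finite_subset[of _ "{..2 * s} \<times> {..<3}"]) (auto simp: in_gens_iff)
  show "root_index s \<in> gens s" by (rule root_in_gens[OF s])
  show "inj_on gen_rank (gens s)" by (rule rank_injective)
  show "gen_rank (root_index s) < gen_rank p" if "p \<in> gens s" "p \<noteq> root_index s" for p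
    by (rule rank_root[OF s that])
  show "bij_betw syz_head (syzs s) (gens s - {root_index s})" by (rule bij_syz_head[OF s])
  show "syz_parent s q \<in> gens s" "gen_rank (syz_parent s q) < gen_rank (syz_head q)" if "q \<in> syzs s" for q
    using syz_parent_properties[OF s that] by simp_all
  show "X (of_nat (snd q)) * Poly_Mapping.single (gen_exp s (syz_head q)) (1::'k) =
      Poly_Mapping.single (cofactor s q) 1 * Poly_Mapping.single (gen_exp s (syz_parent s q)) 1"
    if "q \<in> syzs s" for q
    using syz_parent_properties(4)[OF s that] by (simp add: X_def mult_single add.commute)
  show "x = 0" if "x * Poly_Mapping.single (gen_exp s (root_index s)) (1::'k) = 0" for x
    using that by (rule mult_monomial_eq_0)
  show "x = 0" if "x * X (of_nat (snd q)) = 0" for x :: "(3, 'k) mpoly" and q :: "nat \<times> nat"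
    using that unfolding X_def by (rule mult_monomial_eq_0)
  fix q and v :: "(3, 'k) mpoly"
  let ?p = "syz_head q"
  let ?lower = "{r \<in> gens s. gen_rank r < gen_rank ?p}"
  assume q: "q \<in> syzs s"
    and v: "v * Poly_Mapping.single (gen_exp s ?p) 1 \<in>
      ideal_gen ((\<lambda>r. Poly_Mapping.single (gen_exp s r) (1::'k)) ` ?lower)"
  have p: "?p \<in> gens s" using q in_syzs_iff[OF s] by simp
  have "(\<lambda>r. Poly_Mapping.single (gen_exp s r) (1::'k)) ` ?lower =
      (\<lambda>m. Poly_Mapping.single m 1) ` gen_exp s ` ?lower" by (simp add: image_image)
  then have v: "v * Poly_Mapping.single (gen_exp s ?p) 1 \<in> mono_ideal {g + n | g n. g \<in> gen_exp s ` ?lower}"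
    using v by (simp only: ideal_gen_monomials)
  have "Poly_Mapping.lookup m (of_nat (snd q)) \<noteq> 0" if m: "m \<in> Poly_Mapping.keys v" for m
  proof -
    have "m + gen_exp s ?p \<in> Poly_Mapping.keys (v * Poly_Mapping.single (gen_exp s ?p) 1)"
      using m by (simp add: in_keys_iff lookup_mult_single_add)
    then obtain r n where r: "r \<in> ?lower" and "m + gen_exp s ?p = gen_exp s r + n"
      using v by (auto simp: mono_ideal_def)
    then have "Poly_Mapping.lookup m (of_nat (snd ?p)) + Poly_Mapping.lookup (gen_exp s ?p) (of_nat (snd ?p)) =
        Poly_Mapping.lookup (gen_exp s r) (of_nat (snd ?p)) + Poly_Mapping.lookup n (of_nat (snd ?p))"
      by (metis lookup_add)
    moreover have "Poly_Mapping.lookup (gen_exp s ?p) (of_nat (snd ?p)) <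
        Poly_Mapping.lookup (gen_exp s r) (of_nat (snd ?p))"
      by (rule lower_gen_needs_variable[OF p]) (use r in auto)
    ultimately show ?thesis by (simp add: syz_head_def)
  qed
  then show "\<exists>x. v = x * X (of_nat (snd q))" by (rule X_dvd_if)
qed

definition K3_differentials :: "nat \<Rightarrow> nat \<Rightarrow> nat \<times> nat \<Rightarrow> nat \<times> nat \<Rightarrow> (3, 'k::field) mpoly"
  where "K3_differentials s i p q =
    (if i = 1 then Poly_Mapping.single (gen_exp s q) 1
     else if i = 2 then
       (if p = syz_head q then X (of_nat (snd q)) else 0) -
       (if p = syz_parent s q then Poly_Mapping.single (cofactor s q) 1 else 0)
     else 0)"

lemma free_module_empty: "free_module {} = {\<lambda>_. 0}"
  by (auto simp: free_module_def)

lemma K3_resolution: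
  assumes s: "s \<ge> 1"
  shows "minimal_graded_resolution
    (mono_ideal {m. \<forall>w. s \<le> (\<Sum>v\<in>-{w}. Poly_Mapping.lookup m v)} :: (3, 'k::field) mpoly set)
    (betti_table s) (K3_differentials s)"
proof -
  let ?B = "res_basis (betti_table s)"
  let ?M = "K3_differentials s :: nat \<Rightarrow> nat \<times> nat \<Rightarrow> nat \<times> nat \<Rightarrow> (3, 'k) mpoly"
  let ?g = "\<lambda>p. Poly_Mapping.single (gen_exp s p) (1::'k)"
  interpret tri: triangular_syzygies "gens s" "syzs s" ?g gen_rank "root_index s" syz_head "syz_parent s"
    "\<lambda>q. X (of_nat (snd q))" "\<lambda>q. Poly_Mapping.single (cofactor s q) 1"
    by (rule triangular_syzygies_gens[OF s])
  have B0: "?B 0 = {(0, 0)}" by (auto simp: res_basis_def betti_table_def split: if_splits)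
  have B_empty: "?B (Suc (Suc (Suc n))) = {}" for n by (auto simp: res_basis_def betti_table_def)
  have M2: "?M (Suc (Suc 0)) = tri.syz" by (auto simp: fun_eq_iff K3_differentials_def tri.syz_def)
  have fin: "finite (?B n)" for n
  proof -
    consider "n = 0" | "n = Suc 0" | "n = Suc (Suc 0)" | i where "n = Suc (Suc (Suc i))"
      by (metis not0_implies_Suc)
    then show ?thesis
      by cases (simp_all add: B0 B_empty tri.finite_B tri.finite_C)
  qed
  have entries: "(\<forall>m\<in>Poly_Mapping.keys (?M (Suc i) p q). mono_degree m + fst p = fst q) \<and>
      ?M (Suc i) p q \<in> irrelevant_ideal" if p: "p \<in> ?B i" and q: "q \<in> ?B (Suc i)" for i p q
  proof -
    consider "i = 0" | "i = Suc 0" | j where "i = Suc (Suc j)"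
      by (metis not0_implies_Suc)
    then show ?thesis
    proof cases
      case 1
      then have "mono_degree (gen_exp s q) = fst q" "fst q \<noteq> 0"
        using q mono_degree_gen_exp[of q s] s by (auto simp: in_gens_iff)
      then show ?thesis
        using p 1 by (auto simp: B0 K3_differentials_def intro: single_in_irrelevant_ideal)
    next
      case 2
      then have q: "q \<in> syzs s" using q by simp
      have h: "syz_head q \<in> gens s" "fst q = Suc (fst (syz_head q))"
        using q in_syzs_iff[OF s, of q] by (auto simp: syz_head_def)
      note par = syz_parent_properties[OF s q]
      have "mono_degree (cofactor s q) + fst (syz_parent s q) = fst q"
        using arg_cong[OF par(4), of mono_degree] h
        by (simp add: mono_degree_gen_exp[OF par(1)] mono_degree_gen_exp mono_degree_single)
      moreover from this have "Poly_Mapping.single (cofactor s q) (1::'k) \<in> irrelevant_ideal"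
        using par(3) h(2) by (intro single_in_irrelevant_ideal) linarith
      moreover have "X (of_nat (snd q)) \<in> (irrelevant_ideal :: (3, 'k) mpoly set)"
        unfolding X_def by (rule single_in_irrelevant_ideal) (simp add: mono_degree_single)
      ultimately show ?thesis
        using 2 h(2) tri.par_neq_head[OF q]
        by (auto simp: K3_differentials_def X_def mono_degree_single irrelevant_ideal_def
            intro: ideal.span_zero ideal.span_neg)
    next
      case 3
      then show ?thesis using q by (simp add: B_empty)
    qed
  qed
  have ideal: "ideal_gen (?g ` gens s) = mono_ideal {m. \<forall>w. s \<le> (\<Sum>v\<in>-{w}. Poly_Mapping.lookup m v)}"
    using ideal_gen_monomials[of "gen_exp s ` gens s", where 'k = 'k] gens_generate[OF s]
    by (simp add: image_image)
  have image0: "mat_map (?B 0) (gens s) (?M (Suc 0)) ` free_module (gens s) =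
      {v \<in> free_module (?B 0). v (0, 0) \<in> mono_ideal {m. \<forall>w. s \<le> (\<Sum>v\<in>-{w}. Poly_Mapping.lookup m v)}}"
  proof -
    have "?M (Suc 0) = (\<lambda>_. ?g)" by (simp add: fun_eq_iff K3_differentials_def)
    then show ?thesis using image_row_matrix[OF tri.finite_B, of "(0, 0)" ?g] by (simp add: B0 ideal)
  qed
  have exact: "mat_map (?B (Suc i)) (?B (Suc (Suc i))) (?M (Suc (Suc i))) ` free_module (?B (Suc (Suc i))) =
      {v \<in> free_module (?B (Suc i)). mat_map (?B i) (?B (Suc i)) (?M (Suc i)) v = (\<lambda>_. 0)}" for i
  proof -
    consider "i = 0" | "i = Suc 0" | j where "i = Suc (Suc j)"
      by (metis not0_implies_Suc)
    then show ?thesis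
    proof cases
      case 1
      have "mat_map (?B 0) (gens s) (?M (Suc 0)) v = (\<lambda>_. 0) \<longleftrightarrow> (\<Sum>p\<in>gens s. ?g p * v p) = 0" for v
        by (auto simp: mat_map_def B0 K3_differentials_def fun_eq_iff)
      then show ?thesis using tri.image_eq_syzygies by (simp add: 1 M2)
    next
      case 2
      have "{v \<in> free_module (syzs s). mat_map (gens s) (syzs s) (?M (Suc (Suc 0))) v = (\<lambda>_. 0)} = {\<lambda>_. 0}"
        using tri.syz_injective by (auto simp: M2 free_module_def)
      moreover have "mat_map (syzs s) {} M ` free_module {} = {\<lambda>_. 0}"
        for M :: "nat \<times> nat \<Rightarrow> nat \<times> nat \<Rightarrow> (3, 'k) mpoly"
        by (simp add: free_module_empty)
      ultimately show ?thesis using B_empty[of 0] by (simp add: 2)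
    next
      case 3
      then show ?thesis by (auto simp: B_empty free_module_empty)
    qed
  qed
  show ?thesis
    unfolding minimal_graded_resolution_def
    using fin entries image0 exact by (intro conjI allI ballI) (simp_all add: betti_table_def)
qed

theorem theorem3p10:
  fixes s i j :: nat
  assumes "s \<ge> 1" and "i \<ge> 1" and "j \<ge> 1"
  shows "graded_betti i j
           (symbolic_power (edge_ideal (complete_graph :: 3 set set) :: (3, 'k::field) mpoly set) s) =
         (if i = 1 \<and> real j = 3 * real s / 2 then 1
          else if i = 2 \<and> real j = (3 * real s + 3) / 2 then 2
          else if i = 1 \<and> (3 * real s + 1) / 2 \<le> real j \<and> j \<le> 2 * s then 3
          else if i = 2 \<and> (3 * real s + 4) / 2 \<le> real j \<and> j \<le> 2 * s + 1 then 3
          else 0)"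
proof -
  have betti: "graded_betti i j
      (symbolic_power (edge_ideal (complete_graph :: 3 set set) :: (3, 'k::field) mpoly set) s) = betti_table s i j"
    unfolding symbolic_power_complete_graph by (rule graded_betti_eq[OF K3_resolution[OF assms(1)]])
  have "real j = 3 * real s / 2 \<longleftrightarrow> real (2 * j) = real (3 * s)"
    "real j = (3 * real s + 3) / 2 \<longleftrightarrow> real (2 * j) = real (3 * s + 3)"
    "(3 * real s + 1) / 2 \<le> real j \<longleftrightarrow> real (3 * s + 1) \<le> real (2 * j)"
    "(3 * real s + 4) / 2 \<le> real j \<longleftrightarrow> real (3 * s + 4) \<le> real (2 * j)"
    by (auto simp: field_simps)
  note conv = this[unfolded of_nat_eq_iff of_nat_le_iff]
  have table: "betti_table s i j =
      (if i = 1 \<and> 2 * j = 3 * s then 1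
       else if i = 2 \<and> 2 * j = 3 * s + 3 then 2
       else if i = 1 \<and> 3 * s + 1 \<le> 2 * j \<and> j \<le> 2 * s then 3
       else if i = 2 \<and> 3 * s + 4 \<le> 2 * j \<and> j \<le> 2 * s + 1 then 3
       else 0)"
  proof (cases "i = 2")
    case True
    obtain j' where "j = Suc j'" using assms(3) by (cases j) auto
    then show ?thesis using True assms by (auto simp: betti_table_def gen_count_def root_degree_def)
  qed (use assms in \<open>auto simp: betti_table_def gen_count_def\<close>)
  show ?thesis unfolding betti table conv ..
qed

end
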